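(* Let $G$ be a Banach–Lie group with Lie algebra $\mathbf{L}(G)$, let $\Gamma$ be a finitely generated group, and let $r\in\operatorname{Hom}(\Gamma,G)$. Regard $\mathbf{L}(G)$ as a $\Gamma$-module via $\gamma.v=\operatorname{Ad}(r(\gamma))(v)$. If $H^1(\Gamma,\mathbf{L}(G))=\{0\}$ and the coboundary operator $\delta^1:\operatorname{Map}(S,\mathbf{L}(G))\to\operatorname{Map}(T,\mathbf{L}(G))$ has closed image, then $r$ is locally rigid.
   Context: Local rigidity: $\operatorname{Hom}(\Gamma,G)$ is the set of group homomorphisms $\Gamma\to G$ with the topology of pointwise convergence (equivalently, the compact-open topology with $\Gamma$ discrete). A homomorphism $r\in\operatorname{Hom}(\Gamma,G)$ is locally rigid if there is an open neighborhood $U$ of $r$ in $\operatorname{Hom}(\Gamma,G)$ such that for every $r'\in U$ there exists $g\in G$ with $r'(\gamma)=g\,r(\gamma)\,g^{-1}$ for all $\gamma\in\Gamma$. Presentation: Fix a presentation $1\to R\xrightarrow{\iota}F\xrightarrow{\pi}\Gamma\to 1$ (exact sequence of groups), where $F$ is free on a finite subset $S\subseteq F$ and $R$ is free on a (countable) subset $T\subseteq R$. For $t\in T$ write $\iota(t)=s_{t,1}^{\epsilon_{t,1}}\cdots s_{t,m_t}^{\epsilon_{t,m_t}}$ as a reduced word in $S$, with $s_{t,j}\in S$, $\epsilon_{t,j}=\pm1$. Put $\epsilon'_{t,j}=0$ if $\epsilon_{t,j}=1$ and $\epsilon'_{t,j}=-1$ if $\epsilon_{t,j}=-1$. Coboundary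 operators: For a $\Gamma$-module $V$ and a set $A$, $\operatorname{Map}(A,V)$ is the abelian group of all maps $A\to V$. Define $\delta^0:V\to\operatorname{Map}(S,V)$ and $\delta^1:\operatorname{Map}(S,V)\to\operatorname{Map}(T,V)$ by $$\delta^0(v)(s)=v-\pi(s).v,\qquad \delta^1(c)(t)=\sum_{j=1}^{m_t}\epsilon_{t,j}\,\pi\big(s_{t,1}^{\epsilon_{t,1}}\cdots s_{t,j-1}^{\epsilon_{t,j-1}}s_{t,j}^{\epsilon'_{t,j}}\big).c(s_{t,j}).$$ Then $\delta^1\circ\delta^0=0$, and $H^1(\Gamma,V):=\ker(\delta^1)/\operatorname{im}(\delta^0)$ (this agrees with the usual first group cohomology, cocycles modulo coboundaries). Topology: When $V$ is a Banach space on which each element of $\Gamma$ acts by a continuous linear map (as for $V=\mathbf{L}(G)$), and $A$ is countable, $\operatorname{Map}(A,V)$ is a Fréchet space with the seminorms $p_a(f)=\|f(a)\|$, $a\in A$ (for finite $A$, a Banach space with norm $\sup_{a\in A}\|f(a)\|$). "$\delta^1$ has closed image" means that $\operatorname{im}(\delta^1)$ is a closed subspace of $\operatorname{Map}(T,V)$. *)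

theory Defs
  imports
    "HOL-Analysis.Analysis"
    "HOL-Algebra.Generated_Groups"
    "HOL-Library.Function_Algebras"
begin

section \<open>Smooth maps between open subsets of normed spaces\<close>

text \<open>
  A \<open>k\<close>-linear map is represented as a function on lists of length \<open>k\<close>; its
  values on lists of any other length are irrelevant.
\<close>

definition bounded_multilinear ::
  "nat \<Rightarrow> ('a::real_normed_vector list \<Rightarrow> 'b::real_normed_vector) \<Rightarrow> bool" where
  "bounded_multilinear k m \<longleftrightarrow>
     (\<forall>vs. length vs = k \<longrightarrow> (\<forall>i<k. linear (\<lambda>x. m (vs[i := x])))) \<and>
     (\<exists>C. \<forall>vs. length vs = k \<longrightarrow> norm (m vs) \<le> C * prod_list (map norm vs))"

text \<open>
  \<open>C\<^sup>\<infinity>\<close> in the Frechet sense: \<open>D k x\<close> is the \<open>k\<close>-th derivative of \<open>f\<close> at \<open>x\<close>, and the last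
  condition says that \<open>D (Suc k) x\<close>, seen as a linear map into the \<open>k\<close>-linear maps, is the
  Frechet derivative of \<open>D k\<close> at \<open>x\<close> with respect to the operator norm on bounded
  \<open>k\<close>-linear maps.
\<close>

definition smooth_on ::
  "'a::real_normed_vector set \<Rightarrow> ('a \<Rightarrow> 'b::real_normed_vector) \<Rightarrow> bool" where
  "smooth_on U f \<longleftrightarrow> open U \<and>
     (\<exists>D :: nat \<Rightarrow> 'a \<Rightarrow> 'a list \<Rightarrow> 'b.
        (\<forall>x\<in>U. D 0 x [] = f x) \<and>
        (\<forall>k. \<forall>x\<in>U. bounded_multilinear k (D k x)) \<and>
        (\<forall>k. \<forall>x\<in>U. \<forall>e>0. \<exists>d>0. \<forall>y\<in>U. dist y x < d \<longrightarrow>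
           (\<forall>vs. length vs = k \<longrightarrow>
              norm (D k y vs - D k x vs - D (Suc k) x ((y - x) # vs))
                \<le> e * norm (y - x) * prod_list (map norm vs))))"


section \<open>Banach manifolds\<close>

text \<open>
  A chart is a pair of its domain and its coordinate map; the values of the coordinate map
  outside the domain are irrelevant.
\<close>

type_synonym ('p, 'e) chart = "'p set \<times> ('p \<Rightarrow> 'e)"

definition local_dom :: "('p, 'e) chart \<Rightarrow> ('q, 'f) chart \<Rightarrow> ('p \<Rightarrow> 'q) \<Rightarrow> 'e set" where
  "local_dom c d f = snd c ` {p \<in> fst c. f p \<in> fst d}"

definition local_rep :: "('p, 'e) chart \<Rightarrow> ('q, 'f) chart \<Rightarrow> ('p \<Rightarrow> 'q) \<Rightarrow> 'e \<Rightarrow> 'f" where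
  "local_rep c d f = (\<lambda>x. snd d (f (inv_into (fst c) (snd c) x)))"

definition banach_manifold :: "'p topology \<Rightarrow> ('p, 'e::banach) chart set \<Rightarrow> bool" where
  "banach_manifold X A \<longleftrightarrow>
     Hausdorff_space X \<and>
     (\<Union>c\<in>A. fst c) = topspace X \<and>
     (\<forall>c\<in>A. openin X (fst c) \<and> open (snd c ` fst c) \<and>
        homeomorphic_map (subtopology X (fst c)) (top_of_set (snd c ` fst c)) (snd c)) \<and>
     (\<forall>c\<in>A. \<forall>d\<in>A. smooth_on (local_dom c d id) (local_rep c d id))"

definition smooth_map ::
  "'p topology \<Rightarrow> ('p, 'e::banach) chart set \<Rightarrow> 'q topology \<Rightarrow> ('q, 'f::banach) chart set \<Rightarrow>
   ('p \<Rightarrow> 'q) \<Rightarrow> bool" where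
  "smooth_map X A Y B f \<longleftrightarrow> continuous_map X Y f \<and>
     (\<forall>c\<in>A. \<forall>d\<in>B. smooth_on (local_dom c d f) (local_rep c d f))"

definition prod_atlas ::
  "('p, 'e) chart set \<Rightarrow> ('q, 'f) chart set \<Rightarrow> ('p \<times> 'q, 'e \<times> 'f) chart set" where
  "prod_atlas A B = {(fst c \<times> fst d, map_prod (snd c) (snd d)) | c d. c \<in> A \<and> d \<in> B}"

definition charts_at :: "('p, 'e) chart set \<Rightarrow> 'p \<Rightarrow> ('p, 'e) chart set" where
  "charts_at A p = {c \<in> A. p \<in> fst c}"

text \<open>
  A tangent vector at \<open>p\<close> is the family of its coordinates in all charts around \<open>p\<close>, which
  transform by the derivatives of the chart transitions. The vector space operations are
  the pointwise ones.
\<close>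

definition tangent_space ::
  "('p, 'e::real_normed_vector) chart set \<Rightarrow> 'p \<Rightarrow> (('p, 'e) chart \<Rightarrow> 'e) set" where
  "tangent_space A p =
     {v. (\<forall>c. c \<notin> charts_at A p \<longrightarrow> v c = 0) \<and>
         (\<forall>c\<in>charts_at A p. \<forall>d\<in>charts_at A p.
            v d = frechet_derivative (local_rep c d id) (at (snd c p)) (v c))}"

text \<open>
  The topology of the tangent space is the one of coordinatewise convergence. As each chart
  around \<open>p\<close> makes the tangent space homeomorphic to the model space (lemma
  \<open>tangent_coordinate_homeomorphic\<close> below), this is the topology of any of the equivalent Banach
  space norms \<open>v \<mapsto> norm (v c)\<close>.
\<close>

definition tangent_topology ::
  "('p, 'e::real_normed_vector) chart set \<Rightarrow> 'p \<Rightarrow> (('p, 'e) chart \<Rightarrow> 'e) topology" where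
  "tangent_topology A p = subtopology euclidean (tangent_space A p)"

lemma smooth_on_has_derivative:
  assumes "smooth_on U f" "x \<in> U"
  shows "(f has_derivative frechet_derivative f (at x)) (at x)"
proof -
  obtain D :: "nat \<Rightarrow> 'a \<Rightarrow> 'a list \<Rightarrow> 'b" where U: "open U"
    and D0: "\<forall>y\<in>U. D 0 y [] = f y"
    and ml: "\<forall>k. \<forall>y\<in>U. bounded_multilinear k (D k y)"
    and dD: "\<forall>k. \<forall>y\<in>U. \<forall>e>0. \<exists>d>0. \<forall>z\<in>U. dist z y < d \<longrightarrow>
           (\<forall>vs. length vs = k \<longrightarrow>
              norm (D k z vs - D k y vs - D (Suc k) y ((z - y) # vs))
                \<le> e * norm (z - y) * prod_list (map norm vs))"
    using assms(1) unfolding smooth_on_def by blast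
  have ml1: "bounded_multilinear 1 (D 1 x)"
    using ml assms(2) by blast
  have "linear (\<lambda>h. D 1 x ([0][0 := h]))"
    using conjunct1[OF ml1[unfolded bounded_multilinear_def], rule_format, of "[0]" 0] by simp
  then have lin: "linear (\<lambda>h. D 1 x [h])"
    by simp
  obtain C where C: "\<And>vs. length vs = 1 \<Longrightarrow> norm (D 1 x vs) \<le> C * prod_list (map norm vs)"
    using ml1 unfolding bounded_multilinear_def by blast
  have "norm (D 1 x [h]) \<le> norm h * C" for h
    using C[of "[h]"] by (simp add: mult.commute)
  with lin have bl: "bounded_linear (\<lambda>h. D 1 x [h])"
    by (auto simp: bounded_linear_def bounded_linear_axioms_def)
  have "(f has_derivative (\<lambda>h. D 1 x [h])) (at x within U)"
    unfolding has_derivative_within_alt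
  proof (intro conjI allI impI bl)
    fix e :: real assume "e > 0"
    from dD[rule_format, OF assms(2) this, of 0] obtain d where "d > 0" and
      d: "\<forall>z\<in>U. dist z x < d \<longrightarrow> norm (D 0 z [] - D 0 x [] - D 1 x [z - x]) \<le> e * norm (z - x)"
      by auto
    then show "\<exists>d>0. \<forall>y\<in>U. norm (y - x) < d \<longrightarrow> norm (f y - f x - D 1 x [y - x]) \<le> e * norm (y - x)"
      using D0 assms(2) by (intro exI[of _ d]) (simp add: dist_norm)
  qed
  then have "(f has_derivative (\<lambda>h. D 1 x [h])) (at x)"
    using at_within_open[OF assms(2) U] by simp
  from frechet_derivative_at[OF this] this show ?thesis
    by simp
qed

context
  fixes X :: "'p topology" and A :: "('p, 'e::banach) chart set"
  assumes M: "banach_manifold X A"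
begin

lemma chart_inj_on:
  assumes "c \<in> A" shows "inj_on (snd c) (fst c)"
proof -
  have "fst c \<subseteq> topspace X"
    using M assms unfolding banach_manifold_def by (metis openin_subset)
  moreover have "homeomorphic_map (subtopology X (fst c)) (top_of_set (snd c ` fst c)) (snd c)"
    using M assms unfolding banach_manifold_def by auto
  ultimately show ?thesis
    by (metis homeomorphic_imp_injective_map topspace_subtopology_subset)
qed

lemma transition_has_derivative:
  assumes "c \<in> charts_at A p" "d \<in> charts_at A p"
  shows "(local_rep c d id has_derivative frechet_derivative (local_rep c d id) (at (snd c p)))
           (at (snd c p))"
proof (rule smooth_on_has_derivative)
  show "smooth_on (local_dom c d id) (local_rep c d id)"
    using M assms by (auto simp: banach_manifold_def charts_at_def)
  show "snd c p \<in> local_dom c d id"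
    using assms by (auto simp: local_dom_def charts_at_def)
qed

lemma transition_trans:
  assumes c: "c \<in> charts_at A p" and d: "d \<in> charts_at A p" and e: "e \<in> charts_at A p"
  shows "frechet_derivative (local_rep d e id) (at (snd d p))
           (frechet_derivative (local_rep c d id) (at (snd c p)) x)
         = frechet_derivative (local_rep c e id) (at (snd c p)) x"
proof -
  have mem: "c \<in> A" "d \<in> A" "e \<in> A" "p \<in> fst c" "p \<in> fst d" "p \<in> fst e"
    using assms by (auto simp: charts_at_def)
  have val: "local_rep c d id (snd c p) = snd d p"
    using mem chart_inj_on by (simp add: local_rep_def)
  have "((\<lambda>x. local_rep d e id (local_rep c d id x)) has_derivative
      (\<lambda>x. frechet_derivative (local_rep d e id) (at (snd d p))
           (frechet_derivative (local_rep c d id) (at (snd c p)) x))) (at (snd c p))"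
    using has_derivative_compose[OF transition_has_derivative[OF c d]]
      transition_has_derivative[OF d e] val by auto
  moreover have op: "open (local_dom c d id)"
    using M mem by (auto simp: banach_manifold_def smooth_on_def)
  moreover have "snd c p \<in> local_dom c d id"
    using mem by (auto simp: local_dom_def)
  moreover have "local_rep d e id (local_rep c d id x) = local_rep c e id x"
    if "x \<in> local_dom c d id" for x
    using that mem chart_inj_on by (auto simp: local_rep_def local_dom_def)
  ultimately have "(local_rep c e id has_derivative
      (\<lambda>x. frechet_derivative (local_rep d e id) (at (snd d p))
           (frechet_derivative (local_rep c d id) (at (snd c p)) x))) (at (snd c p))"
    by (rule has_derivative_transform_within_open)
  from frechet_derivative_at[OF this, symmetric] show ?thesis
    by simp
qed

lemma transition_refl:
  assumes c: "c \<in> charts_at A p"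
  shows "frechet_derivative (local_rep c c id) (at (snd c p)) x = x"
proof -
  have mem: "c \<in> A" "p \<in> fst c"
    using assms by (auto simp: charts_at_def)
  have "((\<lambda>x. x) has_derivative (\<lambda>x. x)) (at (snd c p))"
    by simp
  moreover have "open (snd c ` fst c)" "snd c p \<in> snd c ` fst c"
    using M mem by (auto simp: banach_manifold_def)
  moreover have "x = local_rep c c id x" if "x \<in> snd c ` fst c" for x
    using that mem chart_inj_on by (auto simp: local_rep_def)
  ultimately have "(local_rep c c id has_derivative (\<lambda>x. x)) (at (snd c p))"
    by (rule has_derivative_transform_within_open)
  from frechet_derivative_at[OF this, symmetric] show ?thesis
    by simp
qed

lemma tangent_coordinate_homeomorphic:
  assumes c: "c \<in> charts_at A p"
  shows "homeomorphic_map (tangent_topology A p) euclidean (\<lambda>v. v c)"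
proof -
  define g where "g = (\<lambda>x d. if d \<in> charts_at A p
    then frechet_derivative (local_rep c d id) (at (snd c p)) x else 0)"
  have g_in: "g x \<in> tangent_space A p" for x
    using transition_trans[OF c] by (auto simp: g_def tangent_space_def)
  have cont: "continuous_on UNIV g"
  proof (rule continuous_on_coordinatewise_then_product)
    fix d show "continuous_on UNIV (\<lambda>x. g x d)"
      using transition_has_derivative[OF c, of d]
      by (cases "d \<in> charts_at A p")
        (auto simp: g_def intro!: linear_continuous_on has_derivative_bounded_linear)
  qed
  have "homeomorphic_maps (tangent_topology A p) euclidean (\<lambda>v. v c) g"
    unfolding homeomorphic_maps_def tangent_topology_def
  proof (intro conjI ballI)
    have "continuous_on (tangent_space A p) (\<lambda>v. v c)"
      using continuous_on_product_coordinates subset_UNIV by (rule continuous_on_subset)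
    then show "continuous_map (top_of_set (tangent_space A p)) euclidean (\<lambda>v. v c)"
      by simp
    show "continuous_map euclidean (top_of_set (tangent_space A p)) g"
      using cont g_in by (auto simp: continuous_map_in_subtopology)
    fix v assume "v \<in> topspace (top_of_set (tangent_space A p))"
    then have v: "v \<in> tangent_space A p" by simp
    show "g (v c) = v"
    proof
      fix d
      show "g (v c) d = v d"
      proof (cases "d \<in> charts_at A p")
        case True
        with v c have "v d = frechet_derivative (local_rep c d id) (at (snd c p)) (v c)"
          unfolding tangent_space_def by blast
        with True show ?thesis by (simp add: g_def)
      next
        case False
        with v have "v d = 0"
          unfolding tangent_space_def by blast
        with False show ?thesis by (simp add: g_def)
      qed
    qed
  next
    show "g x c = x" for x
      using transition_refl[OF c] c by (simp add: g_def)
  qed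
  then show ?thesis
    by (rule homeomorphic_maps_imp_map)
qed

end

text \<open>By the chain rule, the choice of the chart \<open>c\<close> does not matter for tangent vectors.\<close>

definition tangent_map ::
  "('p, 'e::real_normed_vector) chart set \<Rightarrow> ('q, 'f::real_normed_vector) chart set \<Rightarrow>
   ('p \<Rightarrow> 'q) \<Rightarrow> 'p \<Rightarrow> (('p, 'e) chart \<Rightarrow> 'e) \<Rightarrow> (('q, 'f) chart \<Rightarrow> 'f)" where
  "tangent_map A B f p v =
     (let c = (SOME c. c \<in> charts_at A p)
      in (\<lambda>d. if d \<in> charts_at B (f p)
              then frechet_derivative (local_rep c d f) (at (snd c p)) (v c) else 0))"


section \<open>Banach-Lie groups\<close>

locale banach_lie_group = group G
  for G :: "('g, 'm) monoid_scheme" (structure) +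
  fixes X :: "'g topology" and A :: "('g, 'e::banach) chart set"
  assumes topspace_eq_carrier: "topspace X = carrier G"
    and manifold: "banach_manifold X A"
    and smooth_mult:
      "smooth_map (prod_topology X X) (prod_atlas A A) X A (\<lambda>(x, y). x \<otimes> y)"
    and smooth_inv: "smooth_map X A X A (\<lambda>x. inv x)"

abbreviation lie_algebra ::
  "('g, 'm) monoid_scheme \<Rightarrow> ('g, 'e::real_normed_vector) chart set \<Rightarrow>
   (('g, 'e) chart \<Rightarrow> 'e) set" where
  "lie_algebra G A \<equiv> tangent_space A \<one>\<^bsub>G\<^esub>"

abbreviation lie_algebra_topology ::
  "('g, 'm) monoid_scheme \<Rightarrow> ('g, 'e::real_normed_vector) chart set \<Rightarrow>
   (('g, 'e) chart \<Rightarrow> 'e) topology" where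
  "lie_algebra_topology G A \<equiv> tangent_topology A \<one>\<^bsub>G\<^esub>"

definition Ad ::
  "('g, 'm) monoid_scheme \<Rightarrow> ('g, 'e::real_normed_vector) chart set \<Rightarrow> 'g \<Rightarrow>
   (('g, 'e) chart \<Rightarrow> 'e) \<Rightarrow> (('g, 'e) chart \<Rightarrow> 'e)" where
  "Ad G A g = tangent_map A A (\<lambda>x. g \<otimes>\<^bsub>G\<^esub> x \<otimes>\<^bsub>G\<^esub> inv\<^bsub>G\<^esub> g) \<one>\<^bsub>G\<^esub>"


section \<open>Local rigidity\<close>

definition Hom ::
  "('c, 'n) monoid_scheme \<Rightarrow> ('g, 'm) monoid_scheme \<Rightarrow> ('c \<Rightarrow> 'g) set" where
  "Hom \<Gamma> G = hom \<Gamma> G \<inter> extensional (carrier \<Gamma>)"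

definition Hom_topology ::
  "('c, 'n) monoid_scheme \<Rightarrow> ('g, 'm) monoid_scheme \<Rightarrow> 'g topology \<Rightarrow> ('c \<Rightarrow> 'g) topology" where
  "Hom_topology \<Gamma> G X = subtopology (product_topology (\<lambda>_. X) (carrier \<Gamma>)) (Hom \<Gamma> G)"

definition locally_rigid ::
  "('c, 'n) monoid_scheme \<Rightarrow> ('g, 'm) monoid_scheme \<Rightarrow> 'g topology \<Rightarrow> ('c \<Rightarrow> 'g) \<Rightarrow> bool" where
  "locally_rigid \<Gamma> G X r \<longleftrightarrow>
     (\<exists>U. openin (Hom_topology \<Gamma> G X) U \<and> r \<in> U \<and>
        (\<forall>r'\<in>U. \<exists>g\<in>carrier G. \<forall>\<gamma>\<in>carrier \<Gamma>. r' \<gamma> = g \<otimes>\<^bsub>G\<^esub> r \<gamma> \<otimes>\<^bsub>G\<^esub> inv\<^bsub>G\<^esub> g))"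


section \<open>Presentations\<close>

text \<open>
  A word in \<open>S\<close> is a list of pairs \<open>(s, \<epsilon>)\<close>, standing for \<open>s\<^sup>\<epsilon>\<close>. The exponent \<open>0\<close> does not
  occur in reduced words, but in the words used to define the operator \<open>\<delta>\<^sup>1\<close>.
\<close>

definition word_val :: "('f, 'n) monoid_scheme \<Rightarrow> ('f \<times> int) list \<Rightarrow> 'f" where
  "word_val F w = foldr (\<lambda>(s, \<epsilon>) x. s [^]\<^bsub>F\<^esub> \<epsilon> \<otimes>\<^bsub>F\<^esub> x) w \<one>\<^bsub>F\<^esub>"

definition reduced_words :: "'f set \<Rightarrow> ('f \<times> int) list set" where
  "reduced_words S =
     {w \<in> lists (S \<times> {1, -1}).
        \<forall>i. Suc i < length w \<longrightarrow> \<not> (fst (w ! i) = fst (w ! Suc i) \<and> snd (w ! i) = - snd (w ! Suc i))}"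

definition free_on :: "('f, 'n) monoid_scheme \<Rightarrow> 'f set \<Rightarrow> bool" where
  "free_on F S \<longleftrightarrow> group F \<and> S \<subseteq> carrier F \<and> bij_betw (word_val F) (reduced_words S) (carrier F)"

definition reduced_word :: "('f, 'n) monoid_scheme \<Rightarrow> 'f set \<Rightarrow> 'f \<Rightarrow> ('f \<times> int) list" where
  "reduced_word F S x = (THE w. w \<in> reduced_words S \<and> word_val F w = x)"

definition finitely_generated_group :: "('c, 'n) monoid_scheme \<Rightarrow> bool" where
  "finitely_generated_group \<Gamma> \<longleftrightarrow>
     group \<Gamma> \<and> (\<exists>B. finite B \<and> B \<subseteq> carrier \<Gamma> \<and> generate \<Gamma> B = carrier \<Gamma>)"

locale presentation =
  fixes R :: "('t, 'k) monoid_scheme" and F :: "('f, 'l) monoid_scheme"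
    and \<Gamma> :: "('c, 'n) monoid_scheme"
    and \<iota> :: "'t \<Rightarrow> 'f" and \<pi> :: "'f \<Rightarrow> 'c" and T :: "'t set" and S :: "'f set"
  assumes free_R: "free_on R T" and countable_T: "countable T"
    and free_F: "free_on F S" and finite_S: "finite S"
    and group_\<Gamma>: "group \<Gamma>"
    and \<iota>_mon: "\<iota> \<in> mon R F"
    and exact: "\<iota> ` carrier R = kernel F \<Gamma> \<pi>"
    and \<pi>_epi: "\<pi> \<in> epi F \<Gamma>"


section \<open>Coboundary operators\<close>

text \<open>
  A \<open>\<Gamma>\<close>-module is given by the set \<open>V\<close> of its elements and by its action \<open>act\<close>. Maps defined
  on a set are extensional, that is, \<open>undefined\<close> off this set.
\<close>

definition Map_group :: "'a set \<Rightarrow> 'v::ab_group_add set \<Rightarrow> ('a \<Rightarrow> 'v) monoid" where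
  "Map_group B V =
     \<lparr>carrier = B \<rightarrow>\<^sub>E V,
      monoid.mult = (\<lambda>f g. \<lambda>b\<in>B. f b + g b),
      one = (\<lambda>b\<in>B. 0)\<rparr>"

definition delta0 ::
  "('f \<Rightarrow> 'c) \<Rightarrow> 'f set \<Rightarrow> ('c \<Rightarrow> 'v \<Rightarrow> 'v::ab_group_add) \<Rightarrow> 'v \<Rightarrow> ('f \<Rightarrow> 'v)" where
  "delta0 \<pi> S act v = (\<lambda>s\<in>S. v - act (\<pi> s) v)"

definition delta1 ::
  "('f, 'l) monoid_scheme \<Rightarrow> ('t \<Rightarrow> 'f) \<Rightarrow> ('f \<Rightarrow> 'c) \<Rightarrow> 't set \<Rightarrow> 'f set \<Rightarrow>
   ('c \<Rightarrow> 'v \<Rightarrow> 'v::ab_group_add) \<Rightarrow> ('f \<Rightarrow> 'v) \<Rightarrow> ('t \<Rightarrow> 'v)" where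
  "delta1 F \<iota> \<pi> T S act c =
     (\<lambda>t\<in>T.
        let w = reduced_word F S (\<iota> t)
        in \<Sum>j<length w.
             let s = fst (w ! j); \<epsilon> = snd (w ! j); \<epsilon>' = (if \<epsilon> = 1 then 0 else -1);
                 x = act (\<pi> (word_val F (take j w @ [(s, \<epsilon>')]))) (c s)
             in if \<epsilon> = 1 then x else - x)"

definition H1 ::
  "('f, 'l) monoid_scheme \<Rightarrow> ('t \<Rightarrow> 'f) \<Rightarrow> ('f \<Rightarrow> 'c) \<Rightarrow> 't set \<Rightarrow> 'f set \<Rightarrow>
   'v set \<Rightarrow> ('c \<Rightarrow> 'v \<Rightarrow> 'v::ab_group_add) \<Rightarrow> ('f \<Rightarrow> 'v) set monoid" where
  "H1 F \<iota> \<pi> T S V act =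
     (Map_group S V)
       \<lparr>carrier := kernel (Map_group S V) (Map_group T V) (delta1 F \<iota> \<pi> T S act)\<rparr>
     Mod (delta0 \<pi> S act ` V)"

end

theory Submission
  imports Defs "HOL-Probability.Discrete_Topology"
begin

text \<open>
  The group \<open>G\<close> is read near \<open>\<one>\<close> in one chart, with model space \<open>E\<close>, and two maps are formed. The
  first, \<open>conjugates\<close>, sends a point \<open>x\<close> of \<open>E\<close> near the origin to the values on the generators \<open>S\<close> of
  \<open>r\<close> conjugated by the group element with coordinate \<open>x\<close>. The second, \<open>relations\<close>, sends a family of
  values on the generators to the resulting values of the relators \<open>T\<close>; these are trivial whenever the
  family comes from a homomorphism \<open>\<Gamma> \<rightarrow> G\<close>. The composition of the two maps is constant near the
  origin, their derivatives at the origin and at \<open>r\<close> are \<open>\<delta>\<^sup>0\<close> and \<open>\<delta>\<^sup>1\<close> written in coordinates, and \<open>H\<^sup>1 = 0\<close> says that these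
  derivatives form an exact sequence. Local rigidity follows if the exactness persists:
  every family of generator values near \<open>r\<close> that satisfies the relations is a value of \<open>conjugates\<close>.

  This is an implicit function theorem without complemented subspaces
  (\<open>exact_sequence_locally_surjective\<close>), obtained by a Newton iteration. Let \<open>y\<close> satisfy the
  relations, let \<open>x\<close> be an approximate solution of \<open>f x = y\<close>, and let \<open>\<rho> = y - f x\<close>. Both \<open>y\<close> and
  \<open>f x\<close> satisfy the relations, hence \<open>g' \<rho>\<close> is small compared with \<open>\<rho>\<close>. As the image of \<open>g'\<close> is
  closed, the open mapping theorem gives a \<open>u\<close>, also small compared with \<open>\<rho>\<close>, with \<open>g' u = g' \<rho>\<close>.
  Then \<open>\<rho> - u\<close> lies in the kernel of \<open>g'\<close>, so it is \<open>f' v\<close> for some \<open>v\<close> of norm at most a constant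
  times \<open>norm \<rho>\<close>, and the error of \<open>x + v\<close> is at most half the error of \<open>x\<close>. Only strict
  differentiability at the base points is used. The target of \<open>g\<close> is a product over the possibly
  infinite set \<open>T\<close>. It is only a Frechet space, but the open mapping theorem
  (\<open>open_mapping_closed_image\<close>) bounds a preimage by finitely many of its coordinates, so finitely
  many relators control the iteration.

  The derivatives are computed by a product rule for logarithmic derivatives: if \<open>H\<close> and \<open>K\<close> have
  the logarithmic derivatives \<open>L\<close> and \<open>M\<close> at \<open>y\<close>, then \<open>H K\<close> has \<open>L + Ad (H y) M\<close>. Applied letter
  by letter to a word, the rule produces the sum that defines \<open>\<delta>\<^sup>1\<close> (\<open>has_log_deriv_word\<close>); applied
  to \<open>x \<rho> (inv x)\<close> it gives \<open>v - Ad \<rho> v\<close>, the formula for \<open>\<delta>\<^sup>0\<close>.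
\<close>


section \<open>Strict differentiability\<close>

text \<open>
  Strict differentiability is the amount of smoothness that a Newton iteration needs: the derivative
  at the single point \<open>x\<close> controls the differences between all pairs of nearby points. Unlike
  continuous differentiability it speaks of one point only, so it passes through compositions of maps
  that are known near one point.
\<close>

definition strict_deriv ::
  "('a::real_normed_vector \<Rightarrow> 'b::real_normed_vector) \<Rightarrow> ('a \<Rightarrow> 'b) \<Rightarrow> 'a \<Rightarrow> bool" where
  "strict_deriv f f' x \<longleftrightarrow> bounded_linear f' \<and>
     (\<forall>e>0. \<exists>d>0. \<forall>y z. norm (y - x) < d \<longrightarrow> norm (z - x) < d \<longrightarrow>
        norm (f y - f z - f' (y - z)) \<le> e * norm (y - z))"

lemma strict_derivD:
  assumes "strict_deriv f f' x" "e > 0"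
  obtains d where "d > 0"
    "\<And>y z. norm (y - x) < d \<Longrightarrow> norm (z - x) < d \<Longrightarrow> norm (f y - f z - f' (y - z)) \<le> e * norm (y - z)"
  using assms unfolding strict_deriv_def by blast

lemma strict_deriv_bounded_linear: "strict_deriv f f' x \<Longrightarrow> bounded_linear f'"
  by (simp add: strict_deriv_def)

lemma strict_deriv_imp_has_derivative:
  assumes "strict_deriv f f' x"
  shows "(f has_derivative f') (at x)"
  unfolding has_derivative_at_alt
proof (intro conjI allI impI)
  show "bounded_linear f'" using assms by (rule strict_deriv_bounded_linear)
  fix e :: real assume "e > 0"
  from strict_derivD[OF assms this] obtain d where "d > 0"
    "\<And>y z. norm (y - x) < d \<Longrightarrow> norm (z - x) < d \<Longrightarrow> norm (f y - f z - f' (y - z)) \<le> e * norm (y - z)"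
    by blast
  then show "\<exists>d>0. \<forall>y. norm (y - x) < d \<longrightarrow> norm (f y - f x - f' (y - x)) \<le> e * norm (y - x)"
    by (intro exI[of _ d]) auto
qed

lemma strict_deriv_unique: "strict_deriv f f' x \<Longrightarrow> strict_deriv f f'' x \<Longrightarrow> f' = f''"
  by (rule has_derivative_unique[OF strict_deriv_imp_has_derivative strict_deriv_imp_has_derivative])

lemma strict_deriv_frechet: "strict_deriv f f' x \<Longrightarrow> frechet_derivative f (at x) = f'"
  by (rule frechet_derivative_at[OF strict_deriv_imp_has_derivative, symmetric])

lemma strict_deriv_isCont: "strict_deriv f f' x \<Longrightarrow> isCont f x"
  using has_derivative_continuous strict_deriv_imp_has_derivative by blast

lemma strict_deriv_bounded_linear_self:
  "bounded_linear f \<Longrightarrow> strict_deriv f f x"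
  unfolding strict_deriv_def by (auto simp: bounded_linear.linear linear_diff intro!: exI[of _ 1])

lemma strict_deriv_const: "strict_deriv (\<lambda>x. c) (\<lambda>v. 0) x"
  unfolding strict_deriv_def by (auto intro!: exI[of _ 1])

lemma strict_deriv_lipschitz:
  assumes "strict_deriv f f' x"
  obtains d B where "d > 0" "B > 0"
    "\<And>y z. norm (y - x) < d \<Longrightarrow> norm (z - x) < d \<Longrightarrow> norm (f y - f z) \<le> B * norm (y - z)"
proof -
  obtain C where C: "C > 0" "\<And>v. norm (f' v) \<le> norm v * C"
    using bounded_linear.pos_bounded[OF strict_deriv_bounded_linear[OF assms]] by blast
  obtain d where d: "d > 0"
    "\<And>y z. norm (y - x) < d \<Longrightarrow> norm (z - x) < d \<Longrightarrow> norm (f y - f z - f' (y - z)) \<le> 1 * norm (y - z)"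
    using strict_derivD[OF assms zero_less_one] by blast
  have "norm (f y - f z) \<le> (1 + C) * norm (y - z)"
    if "norm (y - x) < d" "norm (z - x) < d" for y z
  proof -
    have "norm (f y - f z) \<le> norm (f y - f z - f' (y - z)) + norm (f' (y - z))"
      by (metis diff_add_cancel norm_triangle_ineq)
    also have "\<dots> \<le> 1 * norm (y - z) + norm (y - z) * C"
      by (intro add_mono d C that)
    finally show ?thesis by (simp add: algebra_simps)
  qed
  with d(1) C(1) show ?thesis by (intro that[of d "1 + C"]) auto
qed

lemma strict_deriv_compose:
  assumes f: "strict_deriv f f' x" and g: "strict_deriv g g' (f x)"
  shows "strict_deriv (\<lambda>y. g (f y)) (\<lambda>v. g' (f' v)) x"
  unfolding strict_deriv_def
proof (intro conjI allI impI)
  show "bounded_linear (\<lambda>v. g' (f' v))"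
    by (rule bounded_linear_compose[OF strict_deriv_bounded_linear[OF g] strict_deriv_bounded_linear[OF f]])
  fix e :: real assume e: "e > 0"
  obtain C where C: "C > 0" "\<And>v. norm (g' v) \<le> norm v * C"
    using bounded_linear.pos_bounded[OF strict_deriv_bounded_linear[OF g]] by blast
  obtain d1 B where B: "d1 > 0" "B > 0"
    "\<And>y z. norm (y - x) < d1 \<Longrightarrow> norm (z - x) < d1 \<Longrightarrow> norm (f y - f z) \<le> B * norm (y - z)"
    using strict_deriv_lipschitz[OF f] by metis
  obtain d2 where d2: "d2 > 0" "\<And>y z. norm (y - x) < d2 \<Longrightarrow> norm (z - x) < d2 \<Longrightarrow>
      norm (f y - f z - f' (y - z)) \<le> (e / (2 * C)) * norm (y - z)"
    using strict_derivD[OF f, of "e / (2 * C)"] e C by auto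
  obtain d3 where d3: "d3 > 0" "\<And>y z. norm (y - f x) < d3 \<Longrightarrow> norm (z - f x) < d3 \<Longrightarrow>
      norm (g y - g z - g' (y - z)) \<le> (e / (2 * B)) * norm (y - z)"
    using strict_derivD[OF g, of "e / (2 * B)"] e B by auto
  define d where "d = min d1 (min d2 (d3 / B))"
  have d: "d > 0" "d \<le> d1" "d \<le> d2" and "d \<le> d3 / B"
    using B(1,2) d2(1) d3(1) by (simp_all add: d_def)
  then have dB: "B * d \<le> d3"
    using B(2) by (simp add: pos_le_divide_eq mult.commute)
  have near: "norm (f y - f x) < d3" if "norm (y - x) < d" for y
  proof -
    have "norm (f y - f x) \<le> B * norm (y - x)"
      using that d B by simp
    also have "\<dots> < B * d" using that B by simp
    finally show ?thesis using dB by simp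
  qed
  have "norm (g (f y) - g (f z) - g' (f' (y - z))) \<le> e * norm (y - z)"
    if y: "norm (y - x) < d" and z: "norm (z - x) < d" for y z
  proof -
    interpret g': bounded_linear g' by (rule strict_deriv_bounded_linear[OF g])
    have "g (f y) - g (f z) - g' (f' (y - z))
        = (g (f y) - g (f z) - g' (f y - f z)) + g' (f y - f z - f' (y - z))"
      by (simp add: g'.diff)
    then have "norm (g (f y) - g (f z) - g' (f' (y - z)))
        \<le> norm (g (f y) - g (f z) - g' (f y - f z)) + norm (g' (f y - f z - f' (y - z)))"
      by (metis norm_triangle_ineq)
    also have "\<dots> \<le> e / (2 * B) * norm (f y - f z) + norm (f y - f z - f' (y - z)) * C"
      by (intro add_mono d3 C near y z)
    also have "\<dots> \<le> e / (2 * B) * (B * norm (y - z)) + (e / (2 * C) * norm (y - z)) * C"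
      using d y z e B C by (intro add_mono mult_left_mono mult_right_mono B d2) auto
    also have "\<dots> = e * norm (y - z)"
      using B C by (simp add: field_simps)
    finally show ?thesis .
  qed
  with d(1) show "\<exists>d>0. \<forall>y z. norm (y - x) < d \<longrightarrow> norm (z - x) < d \<longrightarrow>
      norm (g (f y) - g (f z) - g' (f' (y - z))) \<le> e * norm (y - z)"
    by blast
qed

lemma strict_deriv_Pair:
  assumes f: "strict_deriv f f' x" and g: "strict_deriv g g' x"
  shows "strict_deriv (\<lambda>y. (f y, g y)) (\<lambda>v. (f' v, g' v)) x"
  unfolding strict_deriv_def
proof (intro conjI allI impI)
  show "bounded_linear (\<lambda>v. (f' v, g' v))"
    by (rule bounded_linear_Pair[OF strict_deriv_bounded_linear[OF f] strict_deriv_bounded_linear[OF g]])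
  fix e :: real assume e: "e > 0"
  obtain d1 where d1: "d1 > 0" "\<And>y z. norm (y - x) < d1 \<Longrightarrow> norm (z - x) < d1 \<Longrightarrow>
      norm (f y - f z - f' (y - z)) \<le> (e / 2) * norm (y - z)"
    using strict_derivD[OF f, of "e / 2"] e by auto
  obtain d2 where d2: "d2 > 0" "\<And>y z. norm (y - x) < d2 \<Longrightarrow> norm (z - x) < d2 \<Longrightarrow>
      norm (g y - g z - g' (y - z)) \<le> (e / 2) * norm (y - z)"
    using strict_derivD[OF g, of "e / 2"] e by auto
  have "norm ((f y, g y) - (f z, g z) - (f' (y - z), g' (y - z))) \<le> e * norm (y - z)"
    if "norm (y - x) < min d1 d2" "norm (z - x) < min d1 d2" for y z
    using norm_Pair_le[of "f y - f z - f' (y - z)" "g y - g z - g' (y - z)"] d1(2)[of y z]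
      d2(2)[of y z] that by simp
  with d1(1) d2(1) show "\<exists>d>0. \<forall>y z. norm (y - x) < d \<longrightarrow> norm (z - x) < d \<longrightarrow>
      norm ((f y, g y) - (f z, g z) - (f' (y - z), g' (y - z))) \<le> e * norm (y - z)"
    by (intro exI[of _ "min d1 d2"]) auto
qed

lemma strict_deriv_cong_ev:
  assumes f: "strict_deriv f f' x" and ev: "\<forall>\<^sub>F y in nhds x. f y = g y"
  shows "strict_deriv g f' x"
  unfolding strict_deriv_def
proof (intro conjI allI impI)
  show "bounded_linear f'" using f by (rule strict_deriv_bounded_linear)
  fix e :: real assume e: "e > 0"
  obtain d1 where d1: "d1 > 0" "\<And>y. norm (y - x) < d1 \<Longrightarrow> f y = g y"
    using ev by (auto simp: eventually_nhds_metric dist_norm)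
  obtain d2 where d2: "d2 > 0" "\<And>y z. norm (y - x) < d2 \<Longrightarrow> norm (z - x) < d2 \<Longrightarrow>
      norm (f y - f z - f' (y - z)) \<le> e * norm (y - z)"
    using strict_derivD[OF f, of e] e by auto
  show "\<exists>d>0. \<forall>y z. norm (y - x) < d \<longrightarrow> norm (z - x) < d \<longrightarrow>
      norm (g y - g z - f' (y - z)) \<le> e * norm (y - z)"
    using d1 d2 by (intro exI[of _ "min d1 d2"]) force
qed

text \<open>
  The second derivative makes the first one continuous at \<open>x\<close>, and the mean value inequality on a
  small ball turns this into strictness.
\<close>

lemma smooth_on_strict_deriv:
  assumes "smooth_on U f" "x \<in> U"
  shows "strict_deriv f (frechet_derivative f (at x)) x"
proof -
  obtain D :: "nat \<Rightarrow> 'a \<Rightarrow> 'a list \<Rightarrow> 'b" where U: "open U"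
    and D0: "\<forall>y\<in>U. D 0 y [] = f y"
    and ml: "\<forall>k. \<forall>y\<in>U. bounded_multilinear k (D k y)"
    and dD: "\<forall>k. \<forall>y\<in>U. \<forall>e>0. \<exists>d>0. \<forall>z\<in>U. dist z y < d \<longrightarrow>
           (\<forall>vs. length vs = k \<longrightarrow>
              norm (D k z vs - D k y vs - D (Suc k) y ((z - y) # vs))
                \<le> e * norm (z - y) * prod_list (map norm vs))"
    using assms(1) unfolding smooth_on_def by blast
  have bl: "bounded_linear (\<lambda>h. D 1 y [h])" if "y \<in> U" for y
  proof -
    have ml1: "bounded_multilinear 1 (D 1 y)" using ml that by blast
    have "linear (\<lambda>h. D 1 y ([0][0 := h]))"
      using conjunct1[OF ml1[unfolded bounded_multilinear_def], rule_format, of "[0]" 0] by simp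
    then have lin: "linear (\<lambda>h. D 1 y [h])" by simp
    obtain C where C: "\<And>vs. length vs = 1 \<Longrightarrow> norm (D 1 y vs) \<le> C * prod_list (map norm vs)"
      using ml1 unfolding bounded_multilinear_def by blast
    have "norm (D 1 y [h]) \<le> norm h * C" for h
      using C[of "[h]"] by (simp add: mult.commute)
    with lin show ?thesis by (auto simp: bounded_linear_def bounded_linear_axioms_def)
  qed
  have der: "(f has_derivative (\<lambda>h. D 1 y [h])) (at y)" if y: "y \<in> U" for y
    unfolding at_within_open[OF y U, symmetric] has_derivative_within_alt
  proof (intro conjI allI impI bl y)
    fix e :: real assume "e > 0"
    from dD[rule_format, OF y this, of 0] obtain d where "d > 0" and
      d: "\<forall>z\<in>U. dist z y < d \<longrightarrow> norm (D 0 z [] - D 0 y [] - D 1 y [z - y]) \<le> e * norm (z - y)"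
      by auto
    then show "\<exists>d>0. \<forall>z\<in>U. norm (z - y) < d \<longrightarrow> norm (f z - f y - D 1 y [z - y]) \<le> e * norm (z - y)"
      using D0 y by (intro exI[of _ d]) (simp add: dist_norm)
  qed
  have "strict_deriv f (\<lambda>h. D 1 x [h]) x"
    unfolding strict_deriv_def
  proof (intro conjI allI impI bl assms(2))
    fix e :: real assume e: "e > 0"
    obtain C0 where C0: "\<And>vs. length vs = 2 \<Longrightarrow> norm (D 2 x vs) \<le> C0 * prod_list (map norm vs)"
      using ml[rule_format, OF assms(2), of 2] unfolding bounded_multilinear_def by blast
    define C where "C = \<bar>C0\<bar>"
    have C: "norm (D 2 x [u, v]) \<le> C * (norm u * norm v)" for u v
    proof -
      have "norm (D 2 x [u, v]) \<le> C0 * (norm u * norm v)" using C0[of "[u, v]"] by simp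
      also have "\<dots> \<le> C * (norm u * norm v)" unfolding C_def by (intro mult_right_mono) auto
      finally show ?thesis .
    qed
    have C_pos: "C \<ge> 0" by (simp add: C_def)
    obtain d1 where d1: "d1 > 0" "\<And>z vs. z \<in> U \<Longrightarrow> dist z x < d1 \<Longrightarrow> length vs = 1 \<Longrightarrow>
        norm (D 1 z vs - D 1 x vs - D 2 x ((z - x) # vs)) \<le> 1 * norm (z - x) * prod_list (map norm vs)"
      using dD[rule_format, OF assms(2) zero_less_one, of 1] by (auto simp: numeral_2_eq_2)
    obtain d2 where d2: "d2 > 0" "ball x d2 \<subseteq> U"
      using U assms(2) open_contains_ball by blast
    define d where "d = min d1 (min d2 (e / (1 + C)))"
    have d: "d > 0" "d \<le> d1" "d \<le> d2" and "d \<le> e / (1 + C)"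
      using d1(1) d2(1) e C_pos by (simp_all add: d_def)
    then have dC: "d * (1 + C) \<le> e"
      using C_pos by (simp add: pos_le_divide_eq)
    have close: "onorm (\<lambda>h. D 1 y [h] - D 1 x [h]) \<le> e" if "y \<in> ball x d" for y
    proof (rule onorm_bound[OF less_imp_le[OF e]])
      fix h
      have y: "y \<in> U" "dist y x < d1" "norm (y - x) < d"
        using that d(1-3) d2(2) by (auto simp: dist_norm norm_minus_commute subset_iff)
      have "norm (D 1 y [h] - D 1 x [h])
          \<le> norm (D 1 y [h] - D 1 x [h] - D 2 x [y - x, h]) + norm (D 2 x [y - x, h])"
        by (metis diff_add_cancel norm_triangle_ineq)
      also have "\<dots> \<le> norm (y - x) * norm h + C * (norm (y - x) * norm h)"
        using d1(2)[OF y(1,2), of "[h]"] C[of "y - x" h] by simp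
      also have "\<dots> = (1 + C) * norm (y - x) * norm h" by (simp add: algebra_simps)
      also have "\<dots> \<le> ((1 + C) * d) * norm h"
        using y C_pos by (intro mult_right_mono mult_left_mono) auto
      also have "\<dots> \<le> e * norm h"
        using dC by (intro mult_right_mono) (auto simp: mult.commute)
      finally show "norm (D 1 y [h] - D 1 x [h]) \<le> e * norm h" .
    qed
    have "norm (f y - f z - D 1 x [y - z]) \<le> e * norm (y - z)"
      if "norm (y - x) < d" "norm (z - x) < d" for y z
    proof -
      interpret bounded_linear "\<lambda>h. D 1 x [h]" by (rule bl[OF assms(2)])
      \<comment> \<open>The mean value inequality for \<open>f\<close> minus its linear part at \<open>x\<close>.\<close>
      have "norm ((f y - D 1 x [y]) - (f z - D 1 x [z])) \<le> e * norm (y - z)"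
      proof (rule differentiable_bound[where S = "ball x d" and f' = "\<lambda>y h. D 1 y [h] - D 1 x [h]"])
        fix w assume "w \<in> ball x d"
        then have "w \<in> U" using d d2 by auto
        show "((\<lambda>y. f y - D 1 x [y]) has_derivative (\<lambda>h. D 1 w [h] - D 1 x [h])) (at w within ball x d)"
          by (intro has_derivative_diff has_derivative_at_withinI[OF der[OF \<open>w \<in> U\<close>]]
              bounded_linear_imp_has_derivative bl assms(2))
      qed (use that close in \<open>auto simp: dist_norm norm_minus_commute\<close>)
      moreover have "f y - f z - D 1 x [y - z] = (f y - D 1 x [y]) - (f z - D 1 x [z])"
        by (simp only: diff) simp
      ultimately show ?thesis by (simp only:)
    qed
    with d(1) show "\<exists>d>0. \<forall>y z. norm (y - x) < d \<longrightarrow> norm (z - x) < d \<longrightarrow>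
        norm (f y - f z - D 1 x [y - z]) \<le> e * norm (y - z)"
      by blast
  qed
  then show ?thesis by (simp add: strict_deriv_frechet)
qed


section \<open>Open mappings onto closed subspaces of countable products\<close>

text \<open>
  The convergence criterion of both iterations below. The bound on the limit keeps a preimage within
  a constant of its datum in the first, and the iterates in the domain in the second.
\<close>

lemma geometric_steps_converge:
  fixes x :: "nat \<Rightarrow> 'a::banach"
  assumes "\<And>n. norm (x (Suc n) - x n) \<le> c / 2 ^ n"
  obtains l where "x \<longlonglongrightarrow> l" "norm (l - x 0) \<le> 2 * c"
proof -
  have sm: "summable (\<lambda>n. c / 2 ^ n :: real)"
    using summable_mult[OF summable_geometric[of "1/2 :: real"], of c] by (simp add: power_divide)
  have sums: "(\<lambda>n. c / 2 ^ n) sums (2 * c)"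
    using sums_mult[OF geometric_sums[of "1/2 :: real"], of c] by (simp add: power_divide mult.commute)
  have s: "summable (\<lambda>n. x (Suc n) - x n)"
    by (rule summable_comparison_test'[OF sm, of 0]) (use assms in auto)
  have sn: "summable (\<lambda>n. norm (x (Suc n) - x n))"
    by (rule summable_comparison_test'[OF sm, of 0]) (use assms in auto)
  have "(\<lambda>n. \<Sum>i<n. x (Suc i) - x i) \<longlonglongrightarrow> (\<Sum>i. x (Suc i) - x i)"
    using s by (rule summable_LIMSEQ)
  then have "(\<lambda>n. x n - x 0) \<longlonglongrightarrow> (\<Sum>i. x (Suc i) - x i)"
    by (simp add: sum_lessThan_telescope)
  from tendsto_add[OF this tendsto_const[of "x 0"]]
  have lim: "x \<longlonglongrightarrow> (\<Sum>i. x (Suc i) - x i) + x 0" by simp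
  have "norm (\<Sum>i. x (Suc i) - x i) \<le> (\<Sum>i. norm (x (Suc i) - x i))"
    by (rule summable_norm[OF sn])
  also have "\<dots> \<le> (\<Sum>i. c / 2 ^ i)"
    by (rule suminf_le[OF assms sn sm])
  also have "\<dots> = 2 * c" using sums by (rule sums_unique[symmetric])
  finally show ?thesis using that[OF lim] by simp
qed

text \<open>
  The Baire category half of the open mapping theorem. The image is completely metrizable, as a closed
  subset of a countable product, and it is the union of the closures of the images of the balls of
  radius \<open>n\<close>, so one of these closures contains a basic open set. Such a set restricts only the
  finitely many coordinates \<open>T0\<close>, and translating it to \<open>0\<close> doubles the radius.
\<close>

lemma closed_image_almost_open:
  fixes L :: "'y::real_normed_vector \<Rightarrow> 't \<Rightarrow> 'z::banach"
  assumes K: "subspace K" and T: "countable T"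
    and lin: "\<And>t. t \<in> T \<Longrightarrow> linear (\<lambda>y. L y t)"
    and cl: "closedin (product_topology (\<lambda>_. euclidean) T) ((\<lambda>y. restrict (L y) T) ` K)"
  obtains T0 e M where "finite T0" "T0 \<subseteq> T" "e > 0" "M > 0"
    "\<And>y T1 a. y \<in> K \<Longrightarrow> \<forall>t\<in>T0. norm (L y t) < e \<Longrightarrow> finite T1 \<Longrightarrow> T1 \<subseteq> T \<Longrightarrow> a > 0 \<Longrightarrow>
       \<exists>u\<in>K. norm u \<le> M \<and> (\<forall>t\<in>T1. norm (L (y - u) t) < a)"
proof -
  let ?P = "product_topology (\<lambda>_. euclidean :: 'z topology) T"
  define \<rho> where "\<rho> y = restrict (L y) T" for y
  define I where "I = \<rho> ` K"
  define XI where "XI = subtopology ?P I"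
  define B where "B n = XI closure_of (\<rho> ` (K \<inter> cball 0 (real n)))" for n
  have Isub: "I \<subseteq> topspace ?P" by (auto simp: I_def \<rho>_def)
  have top: "topspace XI = I" using Isub by (auto simp: XI_def)
  have cm: "completely_metrizable_space XI"
    unfolding XI_def I_def \<rho>_def using cl T
    by (intro completely_metrizable_space_closedin)
       (auto simp: completely_metrizable_space_product_topology completely_metrizable_space_euclidean)
  have cover: "(\<Union>n. B n) = I"
  proof
    show "(\<Union>n. B n) \<subseteq> I"
      unfolding B_def using closure_of_subset_topspace top by fastforce
    show "I \<subseteq> (\<Union>n. B n)"
    proof
      fix z assume "z \<in> I"
      then obtain y where y: "y \<in> K" "z = \<rho> y" by (auto simp: I_def)
      obtain n where "norm y \<le> real n" using real_arch_simple by blast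
      with y have "z \<in> \<rho> ` (K \<inter> cball 0 (real n))" by auto
      moreover have "\<rho> ` (K \<inter> cball 0 (real n)) \<subseteq> B n"
        unfolding B_def by (rule closure_of_subset) (auto simp: top I_def)
      ultimately show "z \<in> (\<Union>n. B n)" by blast
    qed
  qed
  have "\<exists>n. XI interior_of (B n) \<noteq> {}"
  proof (rule ccontr)
    assume "\<not> ?thesis"
    then have "XI interior_of \<Union>(range B) = {}"
      by (intro Baire_category_alt disjI1[OF cm]) (auto simp: B_def)
    moreover have "XI interior_of I = I" by (metis interior_of_topspace top)
    moreover have "\<rho> 0 \<in> I" using K by (auto simp: I_def subspace_0)
    ultimately show False using cover by auto
  qed
  then obtain n z0 where z0: "z0 \<in> XI interior_of (B n)" by blast
  then obtain W0 where "openin XI W0" "z0 \<in> W0" "W0 \<subseteq> B n"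
    by (auto simp: interior_of_def)
  then obtain W where W: "openin ?P W" "z0 \<in> W" "W \<inter> I \<subseteq> B n" "z0 \<in> I"
    by (auto simp: XI_def openin_subtopology)
  then obtain y0 where y0: "y0 \<in> K" "z0 = \<rho> y0" by (auto simp: I_def)
  from W(1,2) obtain U where fin: "finite {t \<in> T. U t \<noteq> UNIV}" and
    U: "\<And>t. t \<in> T \<Longrightarrow> open (U t)" "z0 \<in> PiE T U" "PiE T U \<subseteq> W"
    unfolding openin_product_topology_alt by auto
  \<comment> \<open>The coordinates that the basic open set around \<open>z0\<close> restricts.\<close>
  define T0 where "T0 = {t \<in> T. U t \<noteq> UNIV}"
  have "\<exists>e>0. ball (z0 t) e \<subseteq> U t" if "t \<in> T0" for t
    using U that by (auto simp: T0_def PiE_iff open_contains_ball)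
  then obtain \<epsilon> where \<epsilon>: "\<And>t. t \<in> T0 \<Longrightarrow> \<epsilon> t > 0 \<and> ball (z0 t) (\<epsilon> t) \<subseteq> U t" by metis
  define e where "e = Min (insert 1 (\<epsilon> ` T0))"
  have finT0: "finite T0" using fin by (simp add: T0_def)
  have e: "e > 0" "\<And>t. t \<in> T0 \<Longrightarrow> e \<le> \<epsilon> t"
    using \<epsilon> finT0 by (auto simp: e_def)
  have approx: "\<exists>u\<in>K. norm u \<le> real n \<and> (\<forall>t\<in>T1. norm (L y t - L u t) < a)"
    if "\<rho> y \<in> B n" "finite T1" "T1 \<subseteq> T" "a > 0" for y T1 a
  proof -
    define V where "V = PiE T (\<lambda>t. if t \<in> T1 then ball (L y t) a else UNIV)"
    have "openin ?P V"
      unfolding V_def using that by (auto simp: openin_PiE_gen intro!: finite_subset[OF _ that(2)])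
    then have op: "openin XI (V \<inter> I)" by (auto simp: XI_def openin_subtopology)
    have "\<rho> y \<in> I" using that(1) cover by blast
    then have mem: "\<rho> y \<in> V \<inter> I" using that by (auto simp: V_def \<rho>_def)
    have near: "\<forall>W. \<rho> y \<in> W \<and> openin XI W \<longrightarrow> (\<exists>z. z \<in> \<rho> ` (K \<inter> cball 0 (real n)) \<and> z \<in> W)"
      using that(1) unfolding B_def in_closure_of by (rule conjunct2)
    have "\<exists>z. z \<in> \<rho> ` (K \<inter> cball 0 (real n)) \<and> z \<in> V \<inter> I"
      by (rule near[rule_format, OF conjI[OF mem op]])
    then obtain u where u: "u \<in> K" "norm u \<le> real n" "\<rho> u \<in> V" by auto
    have "norm (L y t - L u t) < a" if "t \<in> T1" for t
      using u(3) that \<open>T1 \<subseteq> T\<close> by (auto simp: V_def \<rho>_def PiE_iff dist_norm split: if_splits)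
    with u show ?thesis by blast
  qed
  show ?thesis
  \<comment> \<open>Approximating both \<open>y0 + y\<close> and \<open>y0\<close> costs the radius \<open>n\<close> twice; the \<open>+ 1\<close> makes the bound positive.\<close>
  proof (rule that[of T0 e "2 * real n + 1"])
    fix y T1 and a :: real
    assume y: "y \<in> K" "\<forall>t\<in>T0. norm (L y t) < e" and T1: "finite T1" "T1 \<subseteq> T" and a: "a > 0"
    have Ladd: "L (p + q) t = L p t + L q t" "L (p - q) t = L p t - L q t" if "t \<in> T" for p q t
      using linear_add[OF lin[OF that], of p q] linear_diff[OF lin[OF that], of p q] by simp_all
    have "\<rho> (y0 + y) \<in> PiE T U"
    proof (rule PiE_I)
      fix t assume t: "t \<in> T"
      show "\<rho> (y0 + y) t \<in> U t"
      proof (cases "t \<in> T0")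
        case True
        with y e have "norm (L y t) < \<epsilon> t" by fastforce
        with \<epsilon>[OF True] t show ?thesis
          by (auto simp: \<rho>_def y0 Ladd dist_norm subset_iff)
      qed (use t in \<open>auto simp: T0_def\<close>)
    qed (auto simp: \<rho>_def)
    moreover have "\<rho> (y0 + y) \<in> I" using y y0 K by (auto simp: I_def subspace_add)
    ultimately have "\<rho> (y0 + y) \<in> B n" using U(3) W(3) by blast
    from approx[OF this T1, of "a / 2"] a obtain u1 where
      u1: "u1 \<in> K" "norm u1 \<le> real n" "\<And>t. t \<in> T1 \<Longrightarrow> norm (L (y0 + y) t - L u1 t) < a / 2" by auto
    have "\<rho> y0 \<in> B n" using W y0 by blast
    from approx[OF this T1, of "a / 2"] a obtain u2 where
      u2: "u2 \<in> K" "norm u2 \<le> real n" "\<And>t. t \<in> T1 \<Longrightarrow> norm (L y0 t - L u2 t) < a / 2" by auto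
    have "norm (L (y - (u1 - u2)) t) < a" if "t \<in> T1" for t
    proof -
      have "L (y - (u1 - u2)) t = (L (y0 + y) t - L u1 t) - (L y0 t - L u2 t)"
        using that T1 by (simp add: Ladd subset_iff)
      then have "norm (L (y - (u1 - u2)) t) \<le> norm (L (y0 + y) t - L u1 t) + norm (L y0 t - L u2 t)"
        by (metis norm_triangle_ineq4)
      then show ?thesis using u1(3)[OF that] u2(3)[OF that] by simp
    qed
    moreover have "norm (u1 - u2) \<le> 2 * real n + 1"
      using norm_triangle_ineq4[of u1 u2] u1 u2 by simp
    ultimately show "\<exists>u\<in>K. norm u \<le> 2 * real n + 1 \<and> (\<forall>t\<in>T1. norm (L (y - u) t) < a)"
      using u1 u2 K by (intro bexI[of _ "u1 - u2"]) (auto simp: subspace_diff)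
  qed (use finT0 e in \<open>auto simp: T0_def\<close>)
qed

text \<open>
  Approximate preimages are improved to exact ones by iteration on the residuals: in step \<open>k\<close> the
  residual is halved on \<open>T0\<close>, which keeps the corrections summable, and is made smaller than
  \<open>1 / 2 ^ k\<close> on the coordinates up to number \<open>k\<close> in an enumeration of \<open>T\<close>, which makes it vanish on all of
  \<open>T\<close> in the limit. That the norm of the preimage is bounded by finitely many coordinates is what a
  neighbourhood of \<open>0\<close> in a product gives.
\<close>

theorem open_mapping_closed_image:
  fixes L :: "'y::banach \<Rightarrow> 't \<Rightarrow> 'z::banach"
  assumes K: "subspace K" "closed K" and T: "countable T"
    and lin: "\<And>t. t \<in> T \<Longrightarrow> bounded_linear (\<lambda>y. L y t)"
    and cl: "closedin (product_topology (\<lambda>_. euclidean) T) ((\<lambda>y. restrict (L y) T) ` K)"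
  obtains T0 C where "finite T0" "T0 \<subseteq> T" "C > 0"
    "\<And>y. y \<in> K \<Longrightarrow> \<exists>u\<in>K. (\<forall>t\<in>T. L u t = L y t) \<and> norm u \<le> C * (\<Sum>t\<in>T0. norm (L y t))"
proof -
  obtain T0 e M where T0: "finite T0" "T0 \<subseteq> T" and eM: "e > 0" "M > 0" and
    step: "\<And>y T1 a. y \<in> K \<Longrightarrow> \<forall>t\<in>T0. norm (L y t) < e \<Longrightarrow> finite T1 \<Longrightarrow> T1 \<subseteq> T \<Longrightarrow> a > 0 \<Longrightarrow>
       \<exists>u\<in>K. norm u \<le> M \<and> (\<forall>t\<in>T1. norm (L (y - u) t) < a)"
    using closed_image_almost_open[OF K(1) T bounded_linear.linear[OF lin] cl] by metis
  have L: "L (p - q) t = L p t - L q t" "L (c *\<^sub>R p) t = c *\<^sub>R L p t" if "t \<in> T" for p q c t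
    using linear_diff[OF bounded_linear.linear[OF lin[OF that]], of p q]
      linear_scale[OF bounded_linear.linear[OF lin[OF that]], of c p] by simp_all
  define q where "q y = (\<Sum>t\<in>T0. norm (L y t))" for y
  have q_ge: "norm (L y t) \<le> q y" if "t \<in> T0" for y t
    unfolding q_def using that T0(1) by (intro member_le_sum) auto
  define M' where "M' = 2 * M / e"
  have M': "M' > 0" using eM by (simp add: M'_def)
  have scaled: "\<exists>u\<in>K. norm u \<le> M' * a \<and> (\<forall>t\<in>T1. norm (L (y - u) t) < b)"
    if "y \<in> K" "q y \<le> a" "a > 0" "finite T1" "T1 \<subseteq> T" "b > 0" for y a b T1
  proof -
    \<comment> \<open>Scaling by \<open>s\<close> brings \<open>y\<close> into the range of \<open>step\<close>; the \<open>2\<close> makes the inequality strict.\<close>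
    define s where "s = e / (2 * a)"
    have s: "s > 0" using that eM by (simp add: s_def)
    have "norm (L (s *\<^sub>R y) t) < e" if t: "t \<in> T0" for t
    proof -
      have "norm (L (s *\<^sub>R y) t) = s * norm (L y t)"
        using T0 t s by (simp add: L subset_iff)
      also have "\<dots> \<le> s * a"
        using s q_ge[OF t, of y] \<open>q y \<le> a\<close> by (intro mult_left_mono) auto
      also have "\<dots> < e" using eM \<open>a > 0\<close> by (simp add: s_def)
      finally show ?thesis .
    qed
    from step[OF subspace_scale[OF K(1) that(1)] ballI[OF this] that(4,5), of "s * b"] s that(6)
    obtain u where u: "u \<in> K" "norm u \<le> M" "\<And>t. t \<in> T1 \<Longrightarrow> norm (L (s *\<^sub>R y - u) t) < s * b"
      by auto
    define u' where "u' = inverse s *\<^sub>R u"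
    have "norm (L (y - u') t) < b" if t: "t \<in> T1" for t
    proof -
      have "s *\<^sub>R y - u = s *\<^sub>R (y - u')" using s by (simp add: u'_def algebra_simps)
      then have "s * norm (L (y - u') t) < s * b"
        using u(3)[OF t] t \<open>T1 \<subseteq> T\<close> s L(2)[of t s "y - u'"] by (auto simp: subset_iff)
      then show ?thesis using s by simp
    qed
    moreover have "norm u' \<le> M' * a"
    proof -
      have "norm u' = inverse s * norm u" using s by (simp add: u'_def)
      also have "\<dots> \<le> inverse s * M" using s u(2) by (intro mult_left_mono) auto
      also have "\<dots> = M' * a" using eM that by (simp add: M'_def s_def field_simps)
      finally show ?thesis .
    qed
    moreover have "u' \<in> K" unfolding u'_def by (rule subspace_scale[OF K(1) u(1)])
    ultimately show ?thesis by blast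
  qed
  define E where "E k = {t \<in> T. to_nat_on T t \<le> k}" for k
  have E: "finite (E k)" "E k \<subseteq> T" for k
  proof -
    have "inj_on (to_nat_on T) (E k)" using inj_on_to_nat_on[OF T] by (rule inj_on_subset) (auto simp: E_def)
    moreover have "to_nat_on T ` E k \<subseteq> {..k}" by (auto simp: E_def)
    ultimately show "finite (E k)" by (meson finite_atMost inj_on_finite)
  qed (auto simp: E_def)
  have main: "\<exists>u\<in>K. (\<forall>t\<in>T. L u t = L y t) \<and> norm u \<le> 2 * (M' * a)"
    if y: "y \<in> K" and a: "q y \<le> a" "a > 0" for y a
  proof -
    \<comment> \<open>The sequence consists of residuals; the last conjunct makes it start at \<open>y\<close>.\<close>
    define P where "P k x \<longleftrightarrow> x \<in> K \<and> q x \<le> a / 2 ^ k \<and> (k = 0 \<longrightarrow> x = y)" for k :: nat and x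
    define Q where "Q k x x' \<longleftrightarrow> norm (x' - x) \<le> M' * a / 2 ^ k \<and> (\<forall>t\<in>E k. norm (L x' t) < 1 / 2 ^ k)"
      for k :: nat and x x'
    have "\<exists>f. \<forall>n. P n (f n) \<and> Q n (f n) (f (Suc n))"
    proof (rule dependent_nat_choice)
      show "\<exists>x. P 0 x" using y a by (auto simp: P_def)
      fix x n assume x: "P n x"
      \<comment> \<open>Summed over \<open>T0\<close> the bound \<open>b\<close> stays below \<open>a / 2 ^ Suc n\<close>.\<close>
      define b where "b = min (1 / 2 ^ n) (a / 2 ^ Suc n / (real (card T0) + 1))"
      have b: "b > 0" using a by (simp add: b_def)
      from scaled[of x "a / 2 ^ n" "E n \<union> T0" b] x b E[of n] T0 a
      obtain u where u: "u \<in> K" "norm u \<le> M' * (a / 2 ^ n)"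
        "\<And>t. t \<in> E n \<union> T0 \<Longrightarrow> norm (L (x - u) t) < b"
        by (auto simp: P_def)
      have "q (x - u) \<le> real (card T0) * b"
        unfolding q_def using u(3) by (intro sum_bounded_above) (auto intro: less_imp_le)
      also have "\<dots> \<le> (real (card T0) + 1) * b" using b by simp
      also have "\<dots> \<le> (real (card T0) + 1) * (a / 2 ^ Suc n / (real (card T0) + 1))"
        by (intro mult_left_mono) (auto simp: b_def)
      also have "\<dots> = a / 2 ^ Suc n"
        using of_nat_0_le_iff[of "card T0", where ?'a = real] by simp
      finally have "P (Suc n) (x - u)"
        using x u(1) K(1) by (simp add: P_def subspace_diff)
      moreover have "Q n x (x - u)"
        using u by (force simp: Q_def b_def)
      ultimately show "\<exists>x'. P (Suc n) x' \<and> Q n x x'" by blast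
    qed
    then obtain x where x: "\<And>n. P n (x n)" "\<And>n. Q n (x n) (x (Suc n))" by blast
    obtain l where l: "x \<longlonglongrightarrow> l" "norm (l - x 0) \<le> 2 * (M' * a)"
      by (rule geometric_steps_converge[of x "M' * a"]) (use x(2) in \<open>auto simp: Q_def\<close>)
    have lK: "l \<in> K"
      using K(2) l(1) x(1) unfolding closed_sequential_limits P_def by blast
    have "L l t = 0" if t: "t \<in> T" for t
    proof -
      have "(\<lambda>n. L (x (Suc n)) t) \<longlonglongrightarrow> L l t"
        using bounded_linear.tendsto[OF lin[OF t] LIMSEQ_Suc[OF l(1)]] .
      moreover have "(\<lambda>n. L (x (Suc n)) t) \<longlonglongrightarrow> 0"
      proof (rule Lim_null_comparison)
        show "(\<lambda>n. (1/2 :: real) ^ n) \<longlonglongrightarrow> 0" by (simp add: LIMSEQ_realpow_zero)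
        show "\<forall>\<^sub>F n in sequentially. norm (L (x (Suc n)) t) \<le> (1/2) ^ n"
        proof (rule eventually_sequentiallyI[of "to_nat_on T t"])
          fix n assume "to_nat_on T t \<le> n"
          then have "t \<in> E n" using t by (simp add: E_def)
          with x(2)[of n] show "norm (L (x (Suc n)) t) \<le> (1/2) ^ n"
            by (auto simp: Q_def power_divide intro: less_imp_le)
        qed
      qed
      ultimately show ?thesis by (rule LIMSEQ_unique)
    qed
    moreover have "x 0 = y" using x(1)[of 0] by (simp add: P_def)
    ultimately show ?thesis using lK y l(2) K(1)
      by (intro bexI[of _ "y - l"]) (auto simp: L subspace_diff norm_minus_commute)
  qed
  show ?thesis
  proof (rule that[of T0 "2 * M'"])
    fix y assume y: "y \<in> K"
    show "\<exists>u\<in>K. (\<forall>t\<in>T. L u t = L y t) \<and> norm u \<le> 2 * M' * (\<Sum>t\<in>T0. norm (L y t))"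
    proof (cases "q y = 0")
      case False
      then have "q y > 0" by (metis q_def less_eq_real_def norm_ge_zero sum_nonneg)
      from main[OF y order.refl this] show ?thesis by (simp add: q_def mult.assoc)
    next
      case True
      \<comment> \<open>All coordinates of \<open>L y\<close> vanish, as \<open>y\<close> has preimages of its image of arbitrarily small norm.\<close>
      have "L y t = 0" if t: "t \<in> T" for t
      proof -
        obtain B where B: "B > 0" "\<And>v. norm (L v t) \<le> norm v * B"
          using bounded_linear.pos_bounded[OF lin[OF t]] by blast
        have "norm (L y t) \<le> e" if e: "e > 0" for e
        proof -
          define a where "a = e / (2 * M' * B)"
          have a: "a > 0" using e M' B by (simp add: a_def)
          obtain u where u: "\<forall>t\<in>T. L u t = L y t" "norm u \<le> 2 * (M' * a)"
            using main[OF y _ a] True a by auto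
          have "norm (L y t) \<le> norm u * B" using B(2)[of u] u(1) t by simp
          also have "\<dots> \<le> 2 * (M' * a) * B" using u(2) B(1) by (intro mult_right_mono) auto
          also have "\<dots> = e" using M' B by (simp add: a_def)
          finally show ?thesis .
        qed
        then show ?thesis
          by (metis dense linorder_not_less zero_less_norm_iff)
      qed
      moreover have "0 \<in> K" using K(1) by (rule subspace_0)
      moreover have "L 0 t = 0" if "t \<in> T" for t
        using linear_0[OF bounded_linear.linear[OF lin[OF that]]] by simp
      ultimately show ?thesis using True
        by (intro bexI[of _ 0]) (auto simp: q_def)
    qed
  qed (use T0 M' in auto)
qed


section \<open>Exact sequences of strictly differentiable maps\<close>

text \<open>
  The subspace \<open>K\<close> stands for the space in which \<open>f\<close> takes its values, up to translation. The sequence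
  \<open>f'\<close>, \<open>g'\<close> is exact, the images of both maps are closed (that of \<open>f'\<close> as the kernel of \<open>g'\<close>), and so
  both have preimages bounded in norm. These serve as a substitute for a right inverse of \<open>f'\<close>, which
  need not exist, and give the Newton step \<open>newton\<close> below.
\<close>

theorem exact_sequence_locally_surjective:
  fixes f :: "'x::banach \<Rightarrow> 'y::banach" and g :: "'t \<Rightarrow> 'y \<Rightarrow> 'z::banach"
  assumes K: "subspace K" "closed K" and T: "countable T"
    and f: "strict_deriv f f' x0" and fK: "\<And>x. f x - f x0 \<in> K" and f'K: "\<And>v. f' v \<in> K"
    and g: "\<And>t. t \<in> T \<Longrightarrow> strict_deriv (g t) (\<lambda>y. g' y t) (f x0)"
    and gf: "\<forall>\<^sub>F x in nhds x0. \<forall>t\<in>T. g t (f x) = g t (f x0)"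
    and exact: "\<And>y. y \<in> K \<Longrightarrow> \<forall>t\<in>T. g' y t = 0 \<Longrightarrow> \<exists>v. f' v = y"
    and cl: "closedin (product_topology (\<lambda>_. euclidean) T) ((\<lambda>y. restrict (g' y) T) ` K)"
    and e: "e > 0"
  obtains d where "d > 0"
    "\<And>y. y - f x0 \<in> K \<Longrightarrow> norm (y - f x0) < d \<Longrightarrow> \<forall>t\<in>T. g t y = g t (f x0) \<Longrightarrow>
       \<exists>x. norm (x - x0) < e \<and> f x = y"
proof -
  have lin: "bounded_linear (\<lambda>y. g' y t)" if "t \<in> T" for t
    using g[OF that] by (rule strict_deriv_bounded_linear)
  have g'f': "g' (f' v) t = 0" if t: "t \<in> T" for v t
  proof -
    have ev: "\<forall>\<^sub>F x in nhds x0. g t (f x0) = g t (f x)"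
      using gf t by (auto elim: eventually_mono)
    have "strict_deriv (\<lambda>x. g t (f x)) (\<lambda>v. 0) x0"
      by (rule strict_deriv_cong_ev[OF strict_deriv_const ev])
    from strict_deriv_unique[OF strict_deriv_compose[OF f g[OF t]] this] show ?thesis
      by (rule fun_cong)
  qed
  obtain T0 C where T0: "finite T0" "T0 \<subseteq> T" and C: "C > 0" and
    lift_g: "\<And>y. y \<in> K \<Longrightarrow> \<exists>u\<in>K. (\<forall>t\<in>T. g' u t = g' y t) \<and> norm u \<le> C * (\<Sum>t\<in>T0. norm (g' y t))"
    using open_mapping_closed_image[OF K T lin cl] by metis
  have range_f': "range f' = K \<inter> (\<Inter>t\<in>T. {y. g' y t = 0})"
    using f'K g'f' exact by (auto simp: image_iff) metis
  have "closed (range f')"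
    unfolding range_f' using K(2) lin
    by (intro closed_Int closed_INT ballI closed_Collect_eq linear_continuous_on continuous_on_const) auto
  then have "closedin euclidean (range f')" by simp
  \<comment> \<open>The map \<open>f'\<close> is treated as a map into a product with one factor.\<close>
  have "closedin (product_topology (\<lambda>_. euclidean) {()})
      {z \<in> topspace (product_topology (\<lambda>_. euclidean) {()}). z () \<in> range f'}"
    by (rule closedin_continuous_map_preimage[OF continuous_map_product_projection]) (use \<open>closedin euclidean _\<close> in auto)
  also have "{z \<in> topspace (product_topology (\<lambda>_. euclidean) {()}). z () \<in> range f'}
      = (\<lambda>v. restrict (\<lambda>_. f' v) {()}) ` UNIV"
    by (fastforce simp: image_iff PiE_iff fun_eq_iff restrict_def extensional_def)
  finally have cl_f': "closedin (product_topology (\<lambda>_. euclidean) {()})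
      ((\<lambda>v. restrict (\<lambda>_. f' v) {()}) ` UNIV)" .
  obtain T1 C1 where "finite (T1 :: unit set)" and C1: "C1 > 0" and
    lift1: "\<And>v. v \<in> UNIV \<Longrightarrow> \<exists>u\<in>UNIV. (\<forall>t\<in>{()}. f' u = f' v) \<and> norm u \<le> C1 * (\<Sum>t\<in>T1. norm (f' v))"
    using open_mapping_closed_image[OF subspace_UNIV closed_UNIV countable_finite _ cl_f']
      strict_deriv_bounded_linear[OF f] by (metis finite.emptyI finite.insertI)
  have lift_f: "\<exists>v. f' v = y \<and> norm v \<le> C1 * norm y" if y: "y \<in> K" "\<forall>t\<in>T. g' y t = 0" for y
  proof -
    obtain v where v: "f' v = y" using exact y by blast
    obtain u where u: "f' u = y" "norm u \<le> C1 * (\<Sum>t\<in>T1. norm y)"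
      using lift1[of v] v by auto
    have "real (card T1) \<le> 1" using card_mono[of "UNIV :: unit set" T1] by simp
    then have "(\<Sum>t\<in>T1. norm y) \<le> norm y" by (simp add: mult_left_le_one_le)
    then have "C1 * (\<Sum>t\<in>T1. norm y) \<le> C1 * norm y" using C1 by (intro mult_left_mono) auto
    with u show ?thesis by (intro exI[of _ u]) auto
  qed
  define N where "N = real (card T0)"
  have N: "N \<ge> 0" by (simp add: N_def)
  \<comment> \<open>The strictness \<open>\<eta>\<close> is chosen such that the lift \<open>u\<close> and the linearization error \<open>s\<close> of a Newton step are each at most a quarter of the residual.\<close>
  define \<eta> where "\<eta> = min 1 (min (1 / (4 * (C * N + 1))) (1 / (8 * C1)))"
  have CN: "C * N + 1 > 0" using C N by (simp add: add_nonneg_pos)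
  have \<eta>: "\<eta> > 0" "\<eta> \<le> 1" using C1 CN by (simp_all add: \<eta>_def)
  have \<eta>1: "C * N * \<eta> \<le> 1 / 4"
  proof -
    have "C * N * \<eta> \<le> (C * N + 1) * \<eta>" using \<eta> by simp
    also have "\<dots> \<le> (C * N + 1) * (1 / (4 * (C * N + 1)))"
      using CN by (intro mult_left_mono) (auto simp: \<eta>_def)
    also have "\<dots> = 1 / 4" using CN by simp
    finally show ?thesis .
  qed
  have \<eta>2: "\<eta> * (C1 * 2) \<le> 1 / 4"
  proof -
    have "\<eta> * (C1 * 2) \<le> 1 / (8 * C1) * (C1 * 2)"
      using C1 by (intro mult_right_mono) (auto simp: \<eta>_def)
    then show ?thesis using C1 by simp
  qed
  obtain B0 d0 where d0: "d0 > 0" "B0 > 0" and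
    lip: "\<And>x z. norm (x - x0) < d0 \<Longrightarrow> norm (z - x0) < d0 \<Longrightarrow> norm (f x - f z) \<le> B0 * norm (x - z)"
    using strict_deriv_lipschitz[OF f] by metis
  obtain d1 where d1: "d1 > 0" and
    f_strict: "\<And>x z. norm (x - x0) < d1 \<Longrightarrow> norm (z - x0) < d1 \<Longrightarrow>
      norm (f x - f z - f' (x - z)) \<le> \<eta> * norm (x - z)"
    using strict_derivD[OF f \<eta>(1)] by metis
  obtain d2 where d2: "d2 > 0" and gf2: "\<And>x t. norm (x - x0) < d2 \<Longrightarrow> t \<in> T \<Longrightarrow> g t (f x) = g t (f x0)"
    using gf by (auto simp: eventually_nhds_metric dist_norm)
  have "\<forall>t\<in>T0. \<exists>d>0. \<forall>y z. norm (y - f x0) < d \<longrightarrow> norm (z - f x0) < d \<longrightarrow>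
      norm (g t y - g t z - g' (y - z) t) \<le> \<eta> * norm (y - z)"
    using g T0 \<eta>(1) by (auto simp: strict_deriv_def subset_iff)
  then obtain dg where dg: "\<And>t. t \<in> T0 \<Longrightarrow> dg t > 0"
    "\<And>t y z. t \<in> T0 \<Longrightarrow> norm (y - f x0) < dg t \<Longrightarrow> norm (z - f x0) < dg t \<Longrightarrow>
      norm (g t y - g t z - g' (y - z) t) \<le> \<eta> * norm (y - z)"
    by metis
  define d3 where "d3 = Min (insert 1 (dg ` T0))"
  have d3: "d3 > 0" "\<And>t. t \<in> T0 \<Longrightarrow> d3 \<le> dg t" using dg T0 by (auto simp: d3_def)
  \<comment> \<open>Within \<open>\<delta>\<close> of \<open>x0\<close> the estimates for \<open>f\<close> hold, \<open>g\<close> is constant along \<open>f\<close>, and \<open>f\<close> takes values where those for \<open>g\<close> hold.\<close>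
  define \<delta> where "\<delta> = min (min e d0) (min (min d1 d2) (d3 / B0))"
  have \<delta>: "\<delta> > 0" "\<delta> \<le> e" "\<delta> \<le> d0" "\<delta> \<le> d1" "\<delta> \<le> d2" "\<delta> \<le> d3 / B0"
    using e d0 d1 d2 d3 by (simp_all add: \<delta>_def)
  have f_near: "norm (f x - f x0) < d3" if "norm (x - x0) < \<delta>" for x
  proof -
    have "norm (f x - f x0) \<le> B0 * norm (x - x0)" using lip[of x x0] that \<delta> d0 by simp
    also have "\<dots> < B0 * (d3 / B0)" using that \<delta> d0 by (intro mult_strict_left_mono) auto
    finally show ?thesis using d0 by simp
  qed
  \<comment> \<open>A Newton step is at most \<open>D\<close> times the residual, because \<open>norm (r - u) \<le> 2 * norm r\<close>.\<close>
  define D where "D = C1 * 2"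
  have D: "D > 0" using C1 by (simp add: D_def)
  define d where "d = min d3 (\<delta> / (2 * D))"
  have d: "d > 0" "d \<le> d3" "d \<le> \<delta> / (2 * D)" using d3 \<delta> D by (simp_all add: d_def)
  show ?thesis
  proof (rule that[OF d(1)])
    fix y assume yK: "y - f x0 \<in> K" and yd: "norm (y - f x0) < d" and gy: "\<forall>t\<in>T. g t y = g t (f x0)"
    define \<rho>0 where "\<rho>0 = norm (y - f x0)"
    have small: "2 * (D * \<rho>0) < \<delta>"
    proof -
      have "2 * D * \<rho>0 < 2 * D * (\<delta> / (2 * D))"
        using yd d D by (intro mult_strict_left_mono) (auto simp: \<rho>0_def)
      then show ?thesis using D by simp
    qed
    have newton: "\<exists>x'. norm (y - f x') \<le> norm (y - f x) / 2 \<and> norm (x' - x) \<le> D * norm (y - f x)"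
      if x: "norm (x - x0) < \<delta>" and x': "norm (x - x0) + D * norm (y - f x) < \<delta>" for x
    proof -
      define r where "r = y - f x"
      have "r = (y - f x0) - (f x - f x0)" by (simp add: r_def)
      then have rK: "r \<in> K" using subspace_diff[OF K(1) yK fK[of x]] by (simp only:)
      have g_small: "norm (g' r t) \<le> \<eta> * norm r" if t: "t \<in> T0" for t
      proof -
        have "g t y = g t (f x)" using gy gf2[of x t] t T0 x \<delta> by auto
        then show ?thesis
          using dg(2)[OF t, of y "f x"] f_near[OF x] yd d d3(2)[OF t] by (simp add: r_def)
      qed
      obtain u where u: "u \<in> K" "\<forall>t\<in>T. g' u t = g' r t" "norm u \<le> C * (\<Sum>t\<in>T0. norm (g' r t))"
        using lift_g[OF rK] by blast
      have "(\<Sum>t\<in>T0. norm (g' r t)) \<le> N * (\<eta> * norm r)"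
        unfolding N_def by (rule sum_bounded_above[OF g_small])
      then have "C * (\<Sum>t\<in>T0. norm (g' r t)) \<le> C * (N * (\<eta> * norm r))"
        using C by (intro mult_left_mono) auto
      also have "\<dots> = (C * N * \<eta>) * norm r" by simp
      also have "\<dots> \<le> 1 / 4 * norm r" by (intro mult_right_mono \<eta>1) simp
      finally have u_le: "norm u \<le> norm r / 4" using u(3) by simp
      have "g' (r - u) t = 0" if "t \<in> T" for t
        using linear_diff[OF bounded_linear.linear[OF lin[OF that]], of r u] u(2) that by simp
      with lift_f[of "r - u"] rK u(1) K(1) obtain v where
        v: "f' v = r - u" "norm v \<le> C1 * norm (r - u)" by (auto simp: subspace_diff)
      have "norm (r - u) \<le> 2 * norm r"
        using norm_triangle_ineq4[of r u] u_le norm_ge_zero[of r] by linarith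
      then have "C1 * norm (r - u) \<le> C1 * (2 * norm r)" using C1 by (intro mult_left_mono) auto
      then have v_le: "norm v \<le> D * norm r" using v(2) by (simp add: D_def)
      have "norm ((x + v) - x0) \<le> norm (x - x0) + norm v"
        using norm_triangle_ineq[of "x - x0" v] by (simp add: algebra_simps)
      then have xv: "norm ((x + v) - x0) < \<delta>" using v_le x' by (simp add: r_def)
      define s where "s = f (x + v) - f x - f' v"
      have "norm s \<le> \<eta> * norm v"
        using f_strict[of "x + v" x] xv x \<delta> by (simp add: s_def)
      also have "\<dots> \<le> \<eta> * (D * norm r)" using v_le \<eta> by (intro mult_left_mono) auto
      also have "\<dots> = (\<eta> * (C1 * 2)) * norm r" by (simp add: D_def)
      also have "\<dots> \<le> 1 / 4 * norm r" by (intro mult_right_mono \<eta>2) simp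
      finally have s_le: "norm s \<le> norm r / 4" by simp
      have "y - f (x + v) = u - s" using v(1) by (simp add: r_def s_def algebra_simps)
      then have "norm (y - f (x + v)) = norm (u - s)" by (rule arg_cong)
      then have "norm (y - f (x + v)) \<le> norm r / 2"
        using norm_triangle_ineq4[of u s] u_le s_le by linarith
      then show ?thesis using v_le by (intro exI[of _ "x + v"]) (simp add: r_def)
    qed
    \<comment> \<open>The factor \<open>1 - 1 / 2 ^ n\<close> sums the steps made so far; for \<open>n = 0\<close> it forces \<open>x = x0\<close>.\<close>
    define P where "P n x \<longleftrightarrow> norm (y - f x) \<le> \<rho>0 / 2 ^ n \<and> norm (x - x0) \<le> 2 * (D * \<rho>0) * (1 - 1 / 2 ^ n)"
      for n :: nat and x
    define Q where "Q n x x' \<longleftrightarrow> norm (x' - x) \<le> D * \<rho>0 / 2 ^ n" for n :: nat and x x' :: 'x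
    have \<rho>0: "\<rho>0 \<ge> 0" by (simp add: \<rho>0_def)
    have "\<exists>x. \<forall>n. P n (x n) \<and> Q n (x n) (x (Suc n))"
    proof (rule dependent_nat_choice)
      show "\<exists>x. P 0 x" by (rule exI[of _ x0]) (simp add: P_def \<rho>0_def)
      fix x n assume Px: "P n x"
      have r_le: "D * norm (y - f x) \<le> D * \<rho>0 / 2 ^ n"
        using mult_left_mono[of "norm (y - f x)" "\<rho>0 / 2 ^ n" D] Px D by (simp add: P_def)
      have "norm (x - x0) + D * norm (y - f x) \<le> 2 * (D * \<rho>0) * (1 - 1 / 2 ^ n) + D * \<rho>0 / 2 ^ n"
        using r_le Px by (simp add: P_def)
      also have "\<dots> = 2 * (D * \<rho>0) * (1 - 1 / 2 ^ Suc n)"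
        by (simp add: algebra_simps)
      finally have bound: "norm (x - x0) + D * norm (y - f x) \<le> 2 * (D * \<rho>0) * (1 - 1 / 2 ^ Suc n)" .
      also have "\<dots> \<le> 2 * (D * \<rho>0) * 1" using D \<rho>0 by (intro mult_left_mono) auto
      finally have lt: "norm (x - x0) + D * norm (y - f x) < \<delta>" using small by simp
      moreover have "0 \<le> D * norm (y - f x)" using D by simp
      ultimately have "norm (x - x0) < \<delta>" by linarith
      from newton[OF this lt] obtain x' where
        x': "norm (y - f x') \<le> norm (y - f x) / 2" "norm (x' - x) \<le> D * norm (y - f x)" by blast
      have "norm (x' - x0) \<le> norm (x - x0) + norm (x' - x)"
        using norm_triangle_ineq[of "x - x0" "x' - x"] by simp
      then have "norm (x' - x0) \<le> 2 * (D * \<rho>0) * (1 - 1 / 2 ^ Suc n)"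
        using bound x'(2) by linarith
      moreover have "norm (y - f x') \<le> \<rho>0 / 2 ^ Suc n"
        using x'(1) Px by (simp add: P_def)
      ultimately show "\<exists>x'. P (Suc n) x' \<and> Q n x x'"
        using x'(2) r_le by (intro exI[of _ x']) (simp add: P_def Q_def)
    qed
    then obtain x where x: "\<And>n. P n (x n)" "\<And>n. Q n (x n) (x (Suc n))" by blast
    have x0: "x 0 = x0" using x(1)[of 0] by (simp add: P_def)
    obtain l where l: "x \<longlonglongrightarrow> l" "norm (l - x 0) \<le> 2 * (D * \<rho>0)"
      by (rule geometric_steps_converge[of x "D * \<rho>0"]) (use x(2) in \<open>auto simp: Q_def\<close>)
    have l\<delta>: "norm (l - x0) < \<delta>" using l(2) small x0 by simp
    have x\<delta>: "norm (x n - x0) < \<delta>" for n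
    proof -
      have "norm (x n - x0) \<le> 2 * (D * \<rho>0) * (1 - 1 / 2 ^ n)" using x(1)[of n] by (simp add: P_def)
      also have "\<dots> \<le> 2 * (D * \<rho>0) * 1" using D \<rho>0 by (intro mult_left_mono) auto
      finally show ?thesis using small by simp
    qed
    have "(\<lambda>n. norm (f (x n) - f l)) \<longlonglongrightarrow> 0"
    proof (rule tendsto_sandwich[OF _ _ tendsto_const])
      show "\<forall>\<^sub>F n in sequentially. norm (f (x n) - f l) \<le> B0 * norm (x n - l)"
        using lip x\<delta> l\<delta> \<delta> by (intro always_eventually allI) (meson less_le_trans)
      have "(\<lambda>n. B0 * norm (x n - l)) \<longlonglongrightarrow> B0 * norm (l - l)"
        by (intro tendsto_intros l(1))
      then show "(\<lambda>n. B0 * norm (x n - l)) \<longlonglongrightarrow> 0" by simp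
    qed simp
    then have "(\<lambda>n. f (x n)) \<longlonglongrightarrow> f l"
      using LIM_zero_cancel tendsto_norm_zero_iff by blast
    moreover have "(\<lambda>n. f (x n)) \<longlonglongrightarrow> y"
    proof -
      have "(\<lambda>n. y - f (x n)) \<longlonglongrightarrow> 0"
      proof (rule Lim_null_comparison)
        show "\<forall>\<^sub>F n in sequentially. norm (y - f (x n)) \<le> \<rho>0 * (1/2) ^ n"
          using x(1) by (intro always_eventually allI) (simp add: P_def power_divide)
        show "(\<lambda>n. \<rho>0 * (1/2 :: real) ^ n) \<longlonglongrightarrow> 0"
          by (intro tendsto_mult_right_zero LIMSEQ_realpow_zero) auto
      qed
      from tendsto_diff[OF tendsto_const[of y] this] show ?thesis by simp
    qed
    ultimately have "f l = y" by (rule LIMSEQ_unique)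
    with l\<delta> \<delta> show "\<exists>x. norm (x - x0) < e \<and> f x = y" by (intro exI[of _ l]) auto
  qed
qed


section \<open>Derivatives of manifold-valued maps in charts\<close>

lemma eventually_nhds_isCont:
  assumes "\<forall>\<^sub>F y in nhds (k z). P y" "isCont k z"
  shows "\<forall>\<^sub>F x in nhds z. P (k x)"
  unfolding eventually_nhds_conv_at
proof
  show "\<forall>\<^sub>F x in at z. P (k x)"
    using assms unfolding isCont_def by (rule eventually_compose_filterlim)
  show "P (k z)" using assms(1) by (rule eventually_nhds_x_imp_x)
qed

text \<open>
  The values of \<open>snd c\<close> off the chart domain are irrelevant, so the derivative of the coordinates
  carries information about \<open>H\<close> only because \<open>H\<close> is required to stay in the domain near \<open>y\<close>.
\<close>

definition has_chart_deriv ::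
  "('p, 'e::real_normed_vector) chart set \<Rightarrow> ('a::real_normed_vector \<Rightarrow> 'p) \<Rightarrow> 'a \<Rightarrow>
   ('p, 'e) chart \<Rightarrow> ('a \<Rightarrow> 'e) \<Rightarrow> bool" where
  "has_chart_deriv A H y c L \<longleftrightarrow> c \<in> charts_at A (H y) \<and> (\<forall>\<^sub>F z in nhds y. H z \<in> fst c) \<and>
     strict_deriv (\<lambda>z. snd c (H z)) L y"

lemma has_chart_deriv_unique:
  "has_chart_deriv A H y c L \<Longrightarrow> has_chart_deriv A H y c L' \<Longrightarrow> L = L'"
  unfolding has_chart_deriv_def using strict_deriv_unique by blast

lemma has_chart_deriv_bounded_linear: "has_chart_deriv A H y c L \<Longrightarrow> bounded_linear L"
  unfolding has_chart_deriv_def using strict_deriv_bounded_linear by blast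

lemma has_chart_deriv_cong_ev:
  assumes "has_chart_deriv A H y c L" and ev: "\<forall>\<^sub>F z in nhds y. H z = H' z"
  shows "has_chart_deriv A H' y c L"
proof -
  have "H y = H' y" using ev by (rule eventually_nhds_x_imp_x)
  moreover have "\<forall>\<^sub>F z in nhds y. H' z \<in> fst c"
    using assms unfolding has_chart_deriv_def by (auto elim: eventually_elim2)
  moreover have "strict_deriv (\<lambda>z. snd c (H' z)) L y"
  proof (rule strict_deriv_cong_ev)
    show "strict_deriv (\<lambda>z. snd c (H z)) L y" using assms by (simp add: has_chart_deriv_def)
    show "\<forall>\<^sub>F z in nhds y. snd c (H z) = snd c (H' z)" using ev by (rule eventually_mono) simp
  qed
  ultimately show ?thesis using assms by (simp add: has_chart_deriv_def)
qed

lemma has_chart_deriv_const: "c \<in> charts_at A p \<Longrightarrow> has_chart_deriv A (\<lambda>y. p) y c (\<lambda>v. 0)"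
  by (simp add: has_chart_deriv_def charts_at_def strict_deriv_const)

lemma has_chart_deriv_reparam:
  assumes "has_chart_deriv A H (k z) c L" "strict_deriv k k' z"
  shows "has_chart_deriv A (\<lambda>x. H (k x)) z c (\<lambda>v. L (k' v))"
  using assms eventually_nhds_isCont[OF _ strict_deriv_isCont[OF assms(2)]]
    strict_deriv_compose[OF assms(2)]
  unfolding has_chart_deriv_def by blast

text \<open>
  The chain rule. The local representative of \<open>h\<close> has an open domain, so composing with \<open>h\<close> does not
  leave the target chart near \<open>y\<close>.
\<close>

lemma has_chart_deriv_smooth:
  assumes H: "has_chart_deriv A H y c L" and inj: "inj_on (snd c) (fst c)"
    and h: "smooth_on (local_dom c d h) (local_rep c d h)" and d: "d \<in> charts_at B (h (H y))"
  shows "has_chart_deriv B (\<lambda>z. h (H z)) y d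
    (\<lambda>v. frechet_derivative (local_rep c d h) (at (snd c (H y))) (L v))"
proof -
  have str: "strict_deriv (\<lambda>z. snd c (H z)) L y" and mem: "H y \<in> fst c"
    and ev: "\<forall>\<^sub>F z in nhds y. H z \<in> fst c"
    using H by (auto simp: has_chart_deriv_def charts_at_def)
  have dom: "snd c (H y) \<in> local_dom c d h"
    using mem d by (auto simp: local_dom_def charts_at_def)
  have "open (local_dom c d h)" using h by (simp add: smooth_on_def)
  with dom have "\<forall>\<^sub>F x in nhds (snd c (H y)). x \<in> local_dom c d h" by (simp add: eventually_nhds_in_open)
  from eventually_nhds_isCont[OF this strict_deriv_isCont[OF str]] ev
  have ev2: "\<forall>\<^sub>F z in nhds y. H z \<in> fst c \<and> h (H z) \<in> fst d"
  proof eventually_elim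
    case (elim z)
    then obtain p where "p \<in> fst c" "h p \<in> fst d" "snd c (H z) = snd c p"
      by (auto simp: local_dom_def)
    with inj elim show ?case by (auto dest: inj_onD)
  qed
  have "strict_deriv (\<lambda>z. local_rep c d h (snd c (H z)))
      (\<lambda>v. frechet_derivative (local_rep c d h) (at (snd c (H y))) (L v)) y"
    by (rule strict_deriv_compose[OF str smooth_on_strict_deriv[OF h dom]])
  moreover have "\<forall>\<^sub>F z in nhds y. local_rep c d h (snd c (H z)) = snd d (h (H z))"
    using ev by eventually_elim (simp add: local_rep_def inj)
  ultimately have "strict_deriv (\<lambda>z. snd d (h (H z)))
      (\<lambda>v. frechet_derivative (local_rep c d h) (at (snd c (H y))) (L v)) y"
    by (rule strict_deriv_cong_ev)
  with d ev2 show ?thesis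
    by (auto simp: has_chart_deriv_def elim: eventually_mono)
qed

lemma prod_atlasI:
  "c \<in> A \<Longrightarrow> d \<in> B \<Longrightarrow> (fst c \<times> fst d, map_prod (snd c) (snd d)) \<in> prod_atlas A B"
  unfolding prod_atlas_def by blast

lemma has_chart_deriv_Pair:
  assumes H: "has_chart_deriv A H y c L" and K: "has_chart_deriv B K y d M"
  shows "has_chart_deriv (prod_atlas A B) (\<lambda>z. (H z, K z)) y
    (fst c \<times> fst d, map_prod (snd c) (snd d)) (\<lambda>v. (L v, M v))"
proof -
  have "strict_deriv (\<lambda>z. (snd c (H z), snd d (K z))) (\<lambda>v. (L v, M v)) y"
    using H K by (intro strict_deriv_Pair) (auto simp: has_chart_deriv_def)
  moreover have "\<forall>\<^sub>F z in nhds y. H z \<in> fst c \<and> K z \<in> fst d"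
    using H K by (intro eventually_conj) (auto simp: has_chart_deriv_def)
  moreover have "c \<in> A" "d \<in> B" "H y \<in> fst c" "K y \<in> fst d"
    using H K by (auto simp: has_chart_deriv_def charts_at_def)
  ultimately show ?thesis
    using prod_atlasI[of c A d B] by (simp add: has_chart_deriv_def charts_at_def)
qed

context
  fixes X :: "'p topology" and A :: "('p, 'e::banach) chart set"
  assumes M: "banach_manifold X A"
begin

lemma has_chart_deriv_transition:
  assumes H: "has_chart_deriv A H y c L" and d: "d \<in> charts_at A (H y)"
  shows "has_chart_deriv A H y d
    (\<lambda>v. frechet_derivative (local_rep c d id) (at (snd c (H y))) (L v))"
proof -
  have c: "c \<in> A" using H by (simp add: has_chart_deriv_def charts_at_def)
  have "smooth_on (local_dom c d id) (local_rep c d id)"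
    using M c d by (auto simp: banach_manifold_def charts_at_def)
  from has_chart_deriv_smooth[OF H chart_inj_on[OF M c] this] d show ?thesis by simp
qed

lemma has_chart_deriv_inv_into:
  assumes c: "c \<in> charts_at A p"
  shows "has_chart_deriv A (inv_into (fst c) (snd c)) (snd c p) c (\<lambda>v. v)"
proof -
  have mem: "c \<in> A" "p \<in> fst c" using c by (auto simp: charts_at_def)
  have val: "inv_into (fst c) (snd c) (snd c p) = p"
    using mem chart_inj_on[OF M] by simp
  have "open (snd c ` fst c)" "snd c p \<in> snd c ` fst c"
    using M mem by (auto simp: banach_manifold_def)
  then have ev: "\<forall>\<^sub>F x in nhds (snd c p). x \<in> snd c ` fst c" by (simp add: eventually_nhds_in_open)
  have "strict_deriv (\<lambda>x. snd c (inv_into (fst c) (snd c) x)) (\<lambda>v. v) (snd c p)"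
  proof (rule strict_deriv_cong_ev)
    show "strict_deriv (\<lambda>x. x) (\<lambda>v. v) (snd c p)"
      by (rule strict_deriv_bounded_linear_self) (rule bounded_linear_ident)
    show "\<forall>\<^sub>F x in nhds (snd c p). x = snd c (inv_into (fst c) (snd c) x)"
      using ev by eventually_elim (auto simp: f_inv_into_f)
  qed
  moreover have "\<forall>\<^sub>F x in nhds (snd c p). inv_into (fst c) (snd c) x \<in> fst c"
    using ev by eventually_elim (auto intro: inv_into_into)
  ultimately show ?thesis using c val by (simp add: has_chart_deriv_def)
qed

lemma smooth_map_has_chart_deriv:
  assumes "smooth_map X A Y B h" "has_chart_deriv A H y c L" "d \<in> charts_at B (h (H y))"
  shows "has_chart_deriv B (\<lambda>z. h (H z)) y d
    (\<lambda>v. frechet_derivative (local_rep c d h) (at (snd c (H y))) (L v))"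
proof (rule has_chart_deriv_smooth[OF assms(2)])
  have c: "c \<in> A" using assms by (simp add: has_chart_deriv_def charts_at_def)
  then show "inj_on (snd c) (fst c)" by (rule chart_inj_on[OF M])
  show "smooth_on (local_dom c d h) (local_rep c d h)"
    using assms c by (simp add: smooth_map_def charts_at_def)
qed (rule assms(3))

end


section \<open>Logarithmic derivatives in a Banach-Lie group\<close>

context banach_lie_group
begin

text \<open>
  This is the chart in which \<open>tangent_map\<close>, and hence \<open>Ad\<close>, reads tangent vectors at \<open>\<one>\<close>.
\<close>

definition chart_one :: "('g, 'e) chart" where
  "chart_one = (SOME c. c \<in> charts_at A \<one>)"

lemma charts_at_nonempty:
  assumes "x \<in> carrier G" shows "\<exists>c. c \<in> charts_at A x"
proof -
  have "(\<Union>c\<in>A. fst c) = carrier G"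
    using manifold topspace_eq_carrier by (simp add: banach_manifold_def)
  with assms have "x \<in> (\<Union>c\<in>A. fst c)" by simp
  then show ?thesis unfolding charts_at_def by blast
qed

lemma chart_one: "chart_one \<in> charts_at A \<one>"
  unfolding chart_one_def using charts_at_nonempty[OF one_closed] by (rule someI_ex)

lemma chart_one_mem: "chart_one \<in> A" "\<one> \<in> fst chart_one"
  using chart_one by (auto simp: charts_at_def)

lemma chart_subset_carrier: "c \<in> A \<Longrightarrow> fst c \<subseteq> carrier G"
  using manifold topspace_eq_carrier openin_subset by (fastforce simp: banach_manifold_def)

abbreviation coord :: "'g \<Rightarrow> 'e" where "coord \<equiv> snd chart_one"

abbreviation origin :: 'e where "origin \<equiv> coord \<one>"

lemma inj_coord: "inj_on coord (fst chart_one)"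
  using chart_inj_on[OF manifold chart_one_mem(1)] .

text \<open>
  The inverse of the chart, made total with values in the domain of the chart, so that products of
  its values are group elements for every argument.
\<close>

definition param :: "'e \<Rightarrow> 'g" where
  "param x = (if x \<in> coord ` fst chart_one then inv_into (fst chart_one) coord x else \<one>)"

lemma param_mem: "param x \<in> fst chart_one"
  using chart_one_mem(2) by (auto simp: param_def intro: inv_into_into)

lemma param_closed [simp]: "param x \<in> carrier G"
  using param_mem chart_subset_carrier[OF chart_one_mem(1)] by blast

lemma param_coord: "p \<in> fst chart_one \<Longrightarrow> param (coord p) = p"
  using inj_coord by (simp add: param_def)

lemma param_origin [simp]: "param origin = \<one>"
  using param_coord chart_one_mem by blast

lemma eventually_param_eq: "\<forall>\<^sub>F x in nhds origin. param x = inv_into (fst chart_one) coord x"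
proof -
  have "open (coord ` fst chart_one)" "origin \<in> coord ` fst chart_one"
    using manifold chart_one_mem by (auto simp: banach_manifold_def)
  then have "\<forall>\<^sub>F x in nhds origin. x \<in> coord ` fst chart_one" by (simp add: eventually_nhds_in_open)
  then show ?thesis by eventually_elim (simp add: param_def)
qed

lemma param_has_chart_deriv: "has_chart_deriv A param origin chart_one (\<lambda>v. v)"
  using has_chart_deriv_inv_into[OF manifold chart_one] eventually_param_eq
  by (rule has_chart_deriv_cong_ev[OF _ eventually_mono]) simp

text \<open>
  Differentiability in some chart, for existence arguments: once a derivative in some chart is known
  to exist, its value in \<open>chart_one\<close> follows from the uniqueness of derivatives.
\<close>

definition chart_differentiable :: "('a::real_normed_vector \<Rightarrow> 'g) \<Rightarrow> 'a \<Rightarrow> bool" where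
  "chart_differentiable H y \<longleftrightarrow> (\<forall>z. H z \<in> carrier G) \<and> (\<exists>c L. has_chart_deriv A H y c L)"

lemma chart_differentiableI:
  "has_chart_deriv A H y c L \<Longrightarrow> (\<And>z. H z \<in> carrier G) \<Longrightarrow> chart_differentiable H y"
  unfolding chart_differentiable_def by blast

lemma chart_differentiable_chart:
  assumes "chart_differentiable H y" "c \<in> charts_at A (H y)"
  obtains L where "has_chart_deriv A H y c L"
  using assms has_chart_deriv_transition[OF manifold, of H y _ _ c] that
  by (auto simp: chart_differentiable_def)

lemma chart_differentiable_const: "a \<in> carrier G \<Longrightarrow> chart_differentiable (\<lambda>y. a) y"
  using charts_at_nonempty[of a] by (auto intro: chart_differentiableI has_chart_deriv_const)

lemma has_chart_deriv_mult:
  assumes "has_chart_deriv A H y c L" "has_chart_deriv A K y d M" "e \<in> charts_at A (H y \<otimes> K y)"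
  shows "has_chart_deriv A (\<lambda>z. H z \<otimes> K z) y e
    (\<lambda>v. frechet_derivative
       (local_rep (fst c \<times> fst d, map_prod (snd c) (snd d)) e (\<lambda>(x, y). x \<otimes> y))
       (at (snd c (H y), snd d (K y))) (L v, M v))"
proof -
  let ?cd = "(fst c \<times> fst d, map_prod (snd c) (snd d))"
  have cd: "c \<in> A" "d \<in> A" "e \<in> A"
    using assms by (auto simp: has_chart_deriv_def charts_at_def)
  have "inj_on (snd c) (fst c)" "inj_on (snd d) (fst d)"
    using cd chart_inj_on[OF manifold] by auto
  then have inj: "inj_on (snd ?cd) (fst ?cd)" by (auto simp: inj_on_def)
  have "?cd \<in> prod_atlas A A" using cd by (intro prod_atlasI)
  then have sm: "smooth_on (local_dom ?cd e (\<lambda>(x, y). x \<otimes> y)) (local_rep ?cd e (\<lambda>(x, y). x \<otimes> y))"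
    using smooth_mult cd by (auto simp: smooth_map_def)
  show ?thesis
    using has_chart_deriv_smooth[OF has_chart_deriv_Pair[OF assms(1,2)] inj sm, where B = A] assms(3)
    by simp
qed

lemma chart_differentiable_mult:
  assumes "chart_differentiable H y" "chart_differentiable K y"
  shows "chart_differentiable (\<lambda>z. H z \<otimes> K z) y"
proof -
  obtain c L d M where "has_chart_deriv A H y c L" "has_chart_deriv A K y d M"
    using assms by (auto simp: chart_differentiable_def)
  moreover have cl: "\<And>z. H z \<otimes> K z \<in> carrier G"
    using assms by (auto simp: chart_differentiable_def)
  moreover obtain e where "e \<in> charts_at A (H y \<otimes> K y)" using charts_at_nonempty[OF cl] by blast
  ultimately show ?thesis by (intro chart_differentiableI[OF has_chart_deriv_mult])
qed

lemma chart_differentiable_inv: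
  assumes "chart_differentiable H y"
  shows "chart_differentiable (\<lambda>z. inv (H z)) y"
proof -
  obtain c L where "has_chart_deriv A H y c L"
    using assms by (auto simp: chart_differentiable_def)
  moreover have cl: "\<And>z. inv (H z) \<in> carrier G"
    using assms by (auto simp: chart_differentiable_def)
  moreover obtain e where "e \<in> charts_at A (inv (H y))" using charts_at_nonempty[OF cl] by blast
  ultimately show ?thesis
    by (intro chart_differentiableI[OF smooth_map_has_chart_deriv[OF manifold smooth_inv]])
qed

text \<open>
  The derivative \<open>\<mu>\<close> of the multiplication at \<open>(\<one>, \<one>)\<close> is the addition, because it is linear and the
  equations \<open>x \<otimes> \<one> = x\<close> and \<open>\<one> \<otimes> x = x\<close> determine it on both factors.
\<close>

lemma has_chart_deriv_mult_one:
  assumes H: "has_chart_deriv A H y chart_one L" and K: "has_chart_deriv A K y chart_one M"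
    and "H y = \<one>" "K y = \<one>"
  shows "has_chart_deriv A (\<lambda>z. H z \<otimes> K z) y chart_one (\<lambda>v. L v + M v)"
proof -
  define \<mu> where "\<mu> = frechet_derivative
       (local_rep (fst chart_one \<times> fst chart_one, map_prod coord coord) chart_one (\<lambda>(x, y). x \<otimes> y))
       (at (origin, origin))"
  have const: "has_chart_deriv A (\<lambda>y. \<one>) origin chart_one (\<lambda>v. 0)"
    using chart_one by (rule has_chart_deriv_const)
  have left: "has_chart_deriv A (\<lambda>x. param x \<otimes> \<one>) origin chart_one (\<lambda>v. \<mu> (v, 0))"
    using has_chart_deriv_mult[OF param_has_chart_deriv const, of chart_one] chart_one
    by (simp add: \<mu>_def)
  have right: "has_chart_deriv A (\<lambda>x. \<one> \<otimes> param x) origin chart_one (\<lambda>v. \<mu> (0, v))"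
    using has_chart_deriv_mult[OF const param_has_chart_deriv, of chart_one] chart_one
    by (simp add: \<mu>_def)
  have "(\<lambda>v. \<mu> (v, 0)) = (\<lambda>v. v)" "(\<lambda>v. \<mu> (0, v)) = (\<lambda>v. v)"
    using has_chart_deriv_unique[OF left] has_chart_deriv_unique[OF right] param_has_chart_deriv
    by simp_all
  then have \<mu>: "\<mu> (v, 0) = v" "\<mu> (0, v) = v" for v by (simp_all add: fun_eq_iff)
  have "has_chart_deriv A (\<lambda>p. param (fst p)) (origin, origin) chart_one fst"
    using has_chart_deriv_reparam[OF _ strict_deriv_bounded_linear_self[OF bounded_linear_fst],
        of A param "(origin, origin)" chart_one "\<lambda>v. v"] param_has_chart_deriv by simp
  moreover have "has_chart_deriv A (\<lambda>p. param (snd p)) (origin, origin) chart_one snd"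
    using has_chart_deriv_reparam[OF _ strict_deriv_bounded_linear_self[OF bounded_linear_snd],
        of A param "(origin, origin)" chart_one "\<lambda>v. v"] param_has_chart_deriv by simp
  ultimately have "has_chart_deriv A (\<lambda>p. param (fst p) \<otimes> param (snd p)) (origin, origin) chart_one \<mu>"
    using has_chart_deriv_mult[of "\<lambda>p. param (fst p)" "(origin, origin)" chart_one fst
        "\<lambda>p. param (snd p)" chart_one snd chart_one] chart_one by (simp add: \<mu>_def)
  then have lin: "bounded_linear \<mu>" by (rule has_chart_deriv_bounded_linear)
  have "\<mu> (a, b) = a + b" for a b
    using linear_add[OF bounded_linear.linear[OF lin], of "(a, 0)" "(0, b)"] \<mu> by simp
  moreover have "has_chart_deriv A (\<lambda>z. H z \<otimes> K z) y chart_one (\<lambda>v. \<mu> (L v, M v))"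
    using has_chart_deriv_mult[OF H K, of chart_one] assms(3,4) chart_one by (simp add: \<mu>_def)
  ultimately show ?thesis by simp
qed


subsection \<open>The adjoint representation in coordinates\<close>

text \<open>
  The adjoint action, transported to the model space by \<open>chart_one\<close>.
\<close>

definition adj :: "'g \<Rightarrow> 'e \<Rightarrow> 'e" where
  "adj a = frechet_derivative (local_rep chart_one chart_one (\<lambda>x. a \<otimes> x \<otimes> inv a)) (at origin)"

text \<open>
  Conjugation by \<open>a\<close> is a product of three differentiable maps, each read in charts around its own
  value, so it has some strict derivative; this must be the Frechet derivative that defines \<open>adj\<close> and
  \<open>Ad\<close>.
\<close>

lemma conj_inv_into_has_chart_deriv:
  assumes a: "a \<in> carrier G" and d: "d \<in> charts_at A \<one>"
  shows "has_chart_deriv A (\<lambda>x. a \<otimes> inv_into (fst chart_one) coord x \<otimes> inv a) origin d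
    (frechet_derivative (local_rep chart_one d (\<lambda>x. a \<otimes> x \<otimes> inv a)) (at origin))"
proof -
  have "chart_differentiable param origin"
    using param_has_chart_deriv by (rule chart_differentiableI) simp
  then have "chart_differentiable (\<lambda>x. a \<otimes> param x \<otimes> inv a) origin"
    using a by (intro chart_differentiable_mult chart_differentiable_const) auto
  moreover have "d \<in> charts_at A (a \<otimes> param origin \<otimes> inv a)" using a d by simp
  ultimately obtain L where "has_chart_deriv A (\<lambda>x. a \<otimes> param x \<otimes> inv a) origin d L"
    by (rule chart_differentiable_chart)
  then have D: "has_chart_deriv A (\<lambda>x. a \<otimes> inv_into (fst chart_one) coord x \<otimes> inv a) origin d L"
    by (rule has_chart_deriv_cong_ev) (use eventually_param_eq in \<open>auto elim: eventually_mono\<close>)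
  then have "strict_deriv (local_rep chart_one d (\<lambda>x. a \<otimes> x \<otimes> inv a)) L origin"
    by (simp add: has_chart_deriv_def local_rep_def)
  with D show ?thesis by (simp add: strict_deriv_frechet)
qed

lemma has_chart_deriv_conj:
  assumes a: "a \<in> carrier G" and H: "has_chart_deriv A H y chart_one L" "H y = \<one>"
  shows "has_chart_deriv A (\<lambda>z. a \<otimes> H z \<otimes> inv a) y chart_one (\<lambda>v. adj a (L v))"
proof (rule has_chart_deriv_cong_ev)
  show "has_chart_deriv A (\<lambda>z. a \<otimes> inv_into (fst chart_one) coord (coord (H z)) \<otimes> inv a) y chart_one
      (\<lambda>v. adj a (L v))"
    unfolding adj_def
    using conj_inv_into_has_chart_deriv[OF a chart_one] H
    by (intro has_chart_deriv_reparam[where k = "\<lambda>z. coord (H z)"]) (auto simp: has_chart_deriv_def)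
  have "\<forall>\<^sub>F z in nhds y. H z \<in> fst chart_one" using H by (simp add: has_chart_deriv_def)
  then show "\<forall>\<^sub>F z in nhds y. a \<otimes> inv_into (fst chart_one) coord (coord (H z)) \<otimes> inv a = a \<otimes> H z \<otimes> inv a"
    by eventually_elim (simp add: inj_coord)
qed

lemma conj_param_has_chart_deriv:
  "a \<in> carrier G \<Longrightarrow> has_chart_deriv A (\<lambda>x. a \<otimes> param x \<otimes> inv a) origin chart_one (adj a)"
  using has_chart_deriv_conj[OF _ param_has_chart_deriv] by simp

lemma bounded_linear_adj: "a \<in> carrier G \<Longrightarrow> bounded_linear (adj a)"
  using conj_param_has_chart_deriv by (rule has_chart_deriv_bounded_linear)

lemma adj_one: "adj \<one> v = v"
proof -
  have "has_chart_deriv A (\<lambda>x. \<one> \<otimes> param x \<otimes> inv \<one>) origin chart_one (\<lambda>v. v)"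
    using param_has_chart_deriv by simp
  from has_chart_deriv_unique[OF conj_param_has_chart_deriv[OF one_closed] this] show ?thesis by simp
qed

lemma adj_mult:
  assumes a: "a \<in> carrier G" and b: "b \<in> carrier G"
  shows "adj (a \<otimes> b) v = adj a (adj b v)"
proof -
  have "has_chart_deriv A (\<lambda>x. a \<otimes> (b \<otimes> param x \<otimes> inv b) \<otimes> inv a) origin chart_one (\<lambda>v. adj a (adj b v))"
    using has_chart_deriv_conj[OF a conj_param_has_chart_deriv[OF b]] b by simp
  moreover have "a \<otimes> (b \<otimes> param x \<otimes> inv b) \<otimes> inv a = (a \<otimes> b) \<otimes> param x \<otimes> inv (a \<otimes> b)" for x
    using a b by (simp add: inv_mult_group m_assoc)
  ultimately have "has_chart_deriv A (\<lambda>x. (a \<otimes> b) \<otimes> param x \<otimes> inv (a \<otimes> b)) origin chart_one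
      (\<lambda>v. adj a (adj b v))" by simp
  from has_chart_deriv_unique[OF conj_param_has_chart_deriv[OF m_closed[OF a b]] this] show ?thesis
    by (rule fun_cong)
qed

lemma Ad_apply:
  assumes "a \<in> carrier G"
  shows "Ad G A a v d = (if d \<in> charts_at A \<one>
    then frechet_derivative (local_rep chart_one d (\<lambda>x. a \<otimes> x \<otimes> inv a)) (at origin) (v chart_one) else 0)"
  using assms by (simp add: Ad_def tangent_map_def chart_one_def[symmetric] Let_def)

lemma Ad_chart_one: "a \<in> carrier G \<Longrightarrow> Ad G A a v chart_one = adj a (v chart_one)"
  by (simp add: Ad_apply chart_one adj_def)

text \<open>
  The coordinates of \<open>Ad G A a v\<close> in different charts are derivatives of the same map, so they
  transform by the derivatives of the chart transitions.
\<close>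

lemma Ad_in_lie_algebra:
  assumes a: "a \<in> carrier G"
  shows "Ad G A a v \<in> lie_algebra G A"
  unfolding tangent_space_def
proof (intro CollectI conjI allI impI ballI)
  show "Ad G A a v c = 0" if "c \<notin> charts_at A \<one>" for c
    using that a by (simp add: Ad_apply)
  fix c d assume c: "c \<in> charts_at A \<one>" and d: "d \<in> charts_at A \<one>"
  have val: "a \<otimes> inv_into (fst chart_one) coord origin \<otimes> inv a = \<one>"
    using a chart_one_mem inj_coord by simp
  have "has_chart_deriv A (\<lambda>x. a \<otimes> inv_into (fst chart_one) coord x \<otimes> inv a) origin d
      (\<lambda>v. frechet_derivative (local_rep c d id) (at (snd c \<one>))
        (frechet_derivative (local_rep chart_one c (\<lambda>x. a \<otimes> x \<otimes> inv a)) (at origin) v))"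
    using has_chart_deriv_transition[OF manifold conj_inv_into_has_chart_deriv[OF a c], of d] d
    by (simp add: val)
  from has_chart_deriv_unique[OF conj_inv_into_has_chart_deriv[OF a d] this]
  show "Ad G A a v d = frechet_derivative (local_rep c d id) (at (snd c \<one>)) (Ad G A a v c)"
    using a c d by (simp add: Ad_apply fun_eq_iff)
qed


subsection \<open>Rules for logarithmic derivatives\<close>

text \<open>
  Right translation by \<open>inv (H y)\<close> brings the value of \<open>H\<close> at \<open>y\<close> to \<open>\<one>\<close>, so derivatives of maps with
  different values are compared in one vector space.
\<close>

definition has_log_deriv :: "('a::real_normed_vector \<Rightarrow> 'g) \<Rightarrow> 'a \<Rightarrow> ('a \<Rightarrow> 'e) \<Rightarrow> bool" where
  "has_log_deriv H y L \<longleftrightarrow> (\<forall>z. H z \<in> carrier G) \<and>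
     has_chart_deriv A (\<lambda>z. H z \<otimes> inv (H y)) y chart_one L"

lemma has_log_deriv_closed: "has_log_deriv H y L \<Longrightarrow> H z \<in> carrier G"
  by (simp add: has_log_deriv_def)

lemma has_log_deriv_unique: "has_log_deriv H y L \<Longrightarrow> has_log_deriv H y L' \<Longrightarrow> L = L'"
  unfolding has_log_deriv_def using has_chart_deriv_unique by blast

lemma has_log_deriv_const: "a \<in> carrier G \<Longrightarrow> has_log_deriv (\<lambda>z. a) y (\<lambda>v. 0)"
  using chart_one by (simp add: has_log_deriv_def has_chart_deriv_const)

lemma has_log_deriv_param: "has_log_deriv param origin (\<lambda>v. v)"
  using param_has_chart_deriv by (simp add: has_log_deriv_def)

lemma has_log_deriv_reparam:
  assumes "has_log_deriv H (k z) L" "strict_deriv k k' z"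
  shows "has_log_deriv (\<lambda>x. H (k x)) z (\<lambda>v. L (k' v))"
  using assms has_chart_deriv_reparam[of A "\<lambda>x. H x \<otimes> inv (H (k z))" k z chart_one L k']
  by (simp add: has_log_deriv_def)

text \<open>
  With \<open>a = H y\<close> and \<open>b = K y\<close>, the translated product \<open>H K inv (a b)\<close> is \<open>H inv a\<close> times the conjugate
  by \<open>a\<close> of \<open>K inv b\<close>.
\<close>

lemma has_log_deriv_mult:
  assumes H: "has_log_deriv H y L" and K: "has_log_deriv K y M"
  shows "has_log_deriv (\<lambda>z. H z \<otimes> K z) y (\<lambda>v. L v + adj (H y) (M v))"
proof -
  note cl [simp] = has_log_deriv_closed[OF H] has_log_deriv_closed[OF K]
  have "has_chart_deriv A (\<lambda>z. H y \<otimes> (K z \<otimes> inv (K y)) \<otimes> inv (H y)) y chart_one (\<lambda>v. adj (H y) (M v))"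
    using K by (intro has_chart_deriv_conj) (auto simp: has_log_deriv_def)
  then have "has_chart_deriv A (\<lambda>z. (H z \<otimes> inv (H y)) \<otimes> (H y \<otimes> (K z \<otimes> inv (K y)) \<otimes> inv (H y))) y chart_one
      (\<lambda>v. L v + adj (H y) (M v))"
    using H by (intro has_chart_deriv_mult_one) (auto simp: has_log_deriv_def)
  moreover have "(H z \<otimes> inv (H y)) \<otimes> (H y \<otimes> (K z \<otimes> inv (K y)) \<otimes> inv (H y))
      = H z \<otimes> K z \<otimes> inv (H y \<otimes> K y)" for z
    by (simp add: inv_mult_group m_assoc inv_solve_left' flip: m_assoc[of "inv (H y)" "H y"])
  ultimately show ?thesis by (simp add: has_log_deriv_def)
qed

lemma has_log_deriv_exists:
  assumes "chart_differentiable H y"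
  obtains L where "has_log_deriv H y L"
proof -
  have cl: "H z \<in> carrier G" for z using assms by (simp add: chart_differentiable_def)
  have "chart_differentiable (\<lambda>z. H z \<otimes> inv (H y)) y"
    using assms cl by (intro chart_differentiable_mult chart_differentiable_const) auto
  moreover have "chart_one \<in> charts_at A (H y \<otimes> inv (H y))" using cl chart_one by simp
  ultimately show ?thesis using cl that
    by (auto simp: has_log_deriv_def elim: chart_differentiable_chart)
qed

lemma has_log_deriv_imp_chart_differentiable:
  assumes "has_log_deriv H y L"
  shows "chart_differentiable H y"
proof -
  note cl = has_log_deriv_closed[OF assms]
  have "chart_differentiable (\<lambda>z. H z \<otimes> inv (H y)) y"
    using assms cl by (intro chart_differentiableI[of _ _ chart_one L]) (auto simp: has_log_deriv_def)
  then have "chart_differentiable (\<lambda>z. H z \<otimes> inv (H y) \<otimes> H y) y"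
    by (rule chart_differentiable_mult[OF _ chart_differentiable_const[OF cl]])
  moreover have "H z \<otimes> inv (H y) \<otimes> H y = H z" for z using cl by (simp add: m_assoc)
  ultimately show ?thesis by simp
qed

text \<open>
  Inversion is smooth, so some derivative exists; the product rule for \<open>inv H \<otimes> H = \<one>\<close> determines it.
\<close>

lemma has_log_deriv_inv:
  assumes H: "has_log_deriv H y L"
  shows "has_log_deriv (\<lambda>z. inv (H z)) y (\<lambda>v. - adj (inv (H y)) (L v))"
proof -
  note cl = has_log_deriv_closed[OF H]
  obtain M where M: "has_log_deriv (\<lambda>z. inv (H z)) y M"
    using has_log_deriv_exists[OF chart_differentiable_inv[OF has_log_deriv_imp_chart_differentiable[OF H]]] .
  have "has_log_deriv (\<lambda>z. inv (H z) \<otimes> H z) y (\<lambda>v. M v + adj (inv (H y)) (L v))"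
    by (rule has_log_deriv_mult[OF M H])
  moreover have "has_log_deriv (\<lambda>z. inv (H z) \<otimes> H z) y (\<lambda>v. 0)"
    using has_log_deriv_const[OF one_closed] cl by simp
  ultimately have "(\<lambda>v. M v + adj (inv (H y)) (L v)) = (\<lambda>v. 0)" by (rule has_log_deriv_unique)
  then have "M = (\<lambda>v. - adj (inv (H y)) (L v))" by (auto simp: fun_eq_iff eq_neg_iff_add_eq_0)
  with M show ?thesis by simp
qed

end


section \<open>Finite families as vectors of a Banach space\<close>

text \<open>
  The space of all families of vectors indexed by a finite subset \<open>S\<close> of a type is needed as a Banach
  space. It is realised inside the Banach space of bounded functions on the whole index type, taken
  with its discrete topology, as the closed subspace \<open>families S\<close> of functions that vanish off \<open>S\<close>.
\<close>

instance bcontfun :: (metric_space, banach) banach ..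

definition entry :: "('i discrete \<Rightarrow>\<^sub>C 'b::metric_space) \<Rightarrow> 'i \<Rightarrow> 'b" where
  "entry y i = apply_bcontfun y (discrete i)"

definition family :: "'i set \<Rightarrow> ('i \<Rightarrow> 'b::real_normed_vector) \<Rightarrow> ('i discrete \<Rightarrow>\<^sub>C 'b)" where
  "family S u = Bcontfun (\<lambda>d. if of_discrete d \<in> S then u (of_discrete d) else 0)"

lemma entry_family:
  assumes "finite S"
  shows "entry (family S u) i = (if i \<in> S then u i else 0)"
proof -
  let ?f = "\<lambda>d. if of_discrete d \<in> S then u (of_discrete d) else 0"
  have "continuous_on UNIV ?f"
    by (simp add: continuous_on_open_vimage[OF open_UNIV] open_discrete)
  moreover have "bounded (range ?f)"
    by (rule bounded_subset[of "insert 0 (u ` S)"]) (use assms in \<open>auto intro: finite_imp_bounded\<close>)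
  ultimately have "?f \<in> bcontfun" by (simp add: bcontfun_def)
  then show ?thesis by (simp add: entry_def family_def Bcontfun_inverse discrete_inverse)
qed

lemma entry_eqI: "(\<And>i. entry y i = entry z i) \<Longrightarrow> y = z"
  unfolding entry_def by (rule bcontfun_eqI) (metis of_discrete_inverse)

lemma entry_simps [simp]:
  fixes y z :: "'i discrete \<Rightarrow>\<^sub>C 'b::real_normed_vector"
  shows "entry (y + z) i = entry y i + entry z i" "entry (y - z) i = entry y i - entry z i"
    "entry (a *\<^sub>R y) i = a *\<^sub>R entry y i" "entry 0 i = (0 :: 'b)"
  by (simp_all add: entry_def)

lemma norm_entry_le: "norm (entry y i) \<le> norm y"
  unfolding entry_def by (rule norm_bounded)

lemma norm_le_entries: "(\<And>i. norm (entry y i) \<le> b) \<Longrightarrow> norm y \<le> b"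
  unfolding entry_def by (rule norm_bound) (metis of_discrete_inverse)

lemma norm_family_le:
  assumes "finite S" "b \<ge> 0" "\<And>i. i \<in> S \<Longrightarrow> norm (u i) \<le> b"
  shows "norm (family S u) \<le> b"
  using assms by (intro norm_le_entries) (simp add: entry_family)

lemma bounded_linear_entry:
  "bounded_linear (\<lambda>y :: 'i discrete \<Rightarrow>\<^sub>C 'b::real_normed_vector. entry y i)"
  by (rule bounded_linear_intro[of _ 1]) (auto simp: norm_entry_le)

lemma strict_deriv_family:
  assumes S: "finite S" and f: "\<And>i. i \<in> S \<Longrightarrow> strict_deriv (f i) (f' i) x"
  shows "strict_deriv (\<lambda>y. family S (\<lambda>i. f i y)) (\<lambda>v. family S (\<lambda>i. f' i v)) x"
  unfolding strict_deriv_def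
proof (intro conjI allI impI)
  have bl: "bounded_linear (f' i)" if "i \<in> S" for i
    using f[OF that] by (rule strict_deriv_bounded_linear)
  show "bounded_linear (\<lambda>v. family S (\<lambda>i. f' i v))"
  proof (rule bounded_linear_intro)
    fix v w and a :: real
    show "family S (\<lambda>i. f' i (v + w)) = family S (\<lambda>i. f' i v) + family S (\<lambda>i. f' i w)"
      using S bl by (intro entry_eqI) (auto simp: entry_family bounded_linear.linear linear_add)
    show "family S (\<lambda>i. f' i (a *\<^sub>R v)) = a *\<^sub>R family S (\<lambda>i. f' i v)"
      using S bl by (intro entry_eqI) (auto simp: entry_family bounded_linear.linear linear_scale)
    have "norm (f' i v) \<le> norm v * (\<Sum>i\<in>S. onorm (f' i))" if i: "i \<in> S" for i
    proof -
      have "norm (f' i v) \<le> onorm (f' i) * norm v" using bl[OF i] by (rule onorm)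
      also have "\<dots> \<le> (\<Sum>i\<in>S. onorm (f' i)) * norm v"
        using S i bl by (intro mult_right_mono member_le_sum) (auto intro: onorm_pos_le)
      finally show ?thesis by (simp add: mult.commute)
    qed
    then show "norm (family S (\<lambda>i. f' i v)) \<le> norm v * (\<Sum>i\<in>S. onorm (f' i))"
      using S bl by (intro norm_family_le mult_nonneg_nonneg sum_nonneg) (auto intro: onorm_pos_le)
  qed
  fix e :: real assume e: "e > 0"
  have "\<forall>i\<in>S. \<exists>d>0. \<forall>y z. norm (y - x) < d \<longrightarrow> norm (z - x) < d \<longrightarrow>
      norm (f i y - f i z - f' i (y - z)) \<le> e * norm (y - z)"
    using f e by (simp add: strict_deriv_def)
  then obtain d where d: "\<And>i. i \<in> S \<Longrightarrow> d i > 0"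
    "\<And>i y z. i \<in> S \<Longrightarrow> norm (y - x) < d i \<Longrightarrow> norm (z - x) < d i \<Longrightarrow>
      norm (f i y - f i z - f' i (y - z)) \<le> e * norm (y - z)"
    by metis
  define d0 where "d0 = Min (insert 1 (d ` S))"
  have d0: "d0 > 0" "\<And>i. i \<in> S \<Longrightarrow> d0 \<le> d i" using d(1) S by (auto simp: d0_def)
  have "norm (family S (\<lambda>i. f i y) - family S (\<lambda>i. f i z) - family S (\<lambda>i. f' i (y - z))) \<le> e * norm (y - z)"
    if "norm (y - x) < d0" "norm (z - x) < d0" for y z
  proof (rule norm_le_entries)
    fix i
    show "norm (entry (family S (\<lambda>i. f i y) - family S (\<lambda>i. f i z) - family S (\<lambda>i. f' i (y - z))) i)
        \<le> e * norm (y - z)"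
      using that d0(2)[of i] d(2)[of i y z] e S by (cases "i \<in> S") (auto simp: entry_family)
  qed
  with d0(1) show "\<exists>d>0. \<forall>y z. norm (y - x) < d \<longrightarrow> norm (z - x) < d \<longrightarrow>
      norm (family S (\<lambda>i. f i y) - family S (\<lambda>i. f i z) - family S (\<lambda>i. f' i (y - z))) \<le> e * norm (y - z)"
    by blast
qed

definition families :: "'i set \<Rightarrow> ('i discrete \<Rightarrow>\<^sub>C 'b::real_normed_vector) set" where
  "families S = {y. \<forall>i. i \<notin> S \<longrightarrow> entry y i = 0}"

lemma family_in_families: "finite S \<Longrightarrow> family S u \<in> families S"
  by (simp add: families_def entry_family)

lemma subspace_families: "subspace (families S)"
  by (simp add: subspace_def families_def)

lemma closed_families: "closed (families S)"
proof -
  have "families S = (\<Inter>i\<in>-S. {y. entry y i = 0})" by (auto simp: families_def)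
  also have "closed \<dots>"
    by (intro closed_INT ballI closed_Collect_eq continuous_on_const linear_continuous_on bounded_linear_entry)
  finally show ?thesis .
qed


section \<open>Words evaluated in a group\<close>

text \<open>
  The value of a word under a substitution of group elements for the letters; \<open>word_val\<close> is the case
  of the identical substitution.
\<close>

definition word_subst :: "('g, 'm) monoid_scheme \<Rightarrow> ('f \<Rightarrow> 'g) \<Rightarrow> ('f \<times> int) list \<Rightarrow> 'g" where
  "word_subst G h w = foldr (\<lambda>(s, \<epsilon>) x. h s [^]\<^bsub>G\<^esub> \<epsilon> \<otimes>\<^bsub>G\<^esub> x) w \<one>\<^bsub>G\<^esub>"

lemma word_subst_Nil [simp]: "word_subst G h [] = \<one>\<^bsub>G\<^esub>"
  by (simp add: word_subst_def)

lemma word_subst_Cons [simp]: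
  "word_subst G h ((s, \<epsilon>) # w) = h s [^]\<^bsub>G\<^esub> \<epsilon> \<otimes>\<^bsub>G\<^esub> word_subst G h w"
  by (simp add: word_subst_def)

lemma word_subst_cong:
  "(\<And>s. s \<in> fst ` set w \<Longrightarrow> h s = k s) \<Longrightarrow> word_subst G h w = word_subst G k w"
  by (induction w) auto

lemma (in group) word_subst_closed:
  "(\<And>s. s \<in> fst ` set w \<Longrightarrow> h s \<in> carrier G) \<Longrightarrow> word_subst G h w \<in> carrier G"
  by (induction w) auto

lemma word_val_eq_word_subst: "word_val F w = word_subst F (\<lambda>s. s) w"
  by (simp add: word_val_def word_subst_def)

lemma hom_word_val:
  assumes "group F" "group G" and \<theta>: "\<theta> \<in> hom F G"
    and w: "\<And>s. s \<in> fst ` set w \<Longrightarrow> s \<in> carrier F"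
  shows "\<theta> (word_val F w) = word_subst G \<theta> w"
proof -
  interpret \<theta>: group_hom F G \<theta>
    using assms by (simp add: group_hom_def group_hom_axioms_def)
  show ?thesis
    unfolding word_val_eq_word_subst using w
  proof (induction w)
    case (Cons p w)
    obtain s \<epsilon> where p: "p = (s, \<epsilon>)" by fastforce
    have "s \<in> carrier F" using Cons.prems p by auto
    moreover have "word_subst F (\<lambda>s. s) w \<in> carrier F"
      using Cons.prems by (intro \<theta>.G.word_subst_closed) auto
    moreover have "\<theta> (word_subst F (\<lambda>s. s) w) = word_subst G \<theta> w"
      using Cons.prems by (intro Cons.IH) auto
    ultimately show ?case by (simp add: p \<theta>.hom_int_pow)
  qed simp
qed

text \<open>
  The contribution of the letter in position \<open>j\<close> to the operator \<open>\<delta>\<^sup>1\<close>, that is, to the Fox derivative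
  of the word. For an exponent \<open>-1\<close> the prefix includes the inverse of the letter.
\<close>

definition fox_term ::
  "('g, 'm) monoid_scheme \<Rightarrow> ('f \<Rightarrow> 'g) \<Rightarrow> ('g \<Rightarrow> 'v \<Rightarrow> 'v) \<Rightarrow> ('f \<times> int) list \<Rightarrow> ('f \<Rightarrow> 'v) \<Rightarrow> nat \<Rightarrow>
   'v::ab_group_add" where
  "fox_term G \<rho> act w c j =
     (let s = fst (w ! j); \<epsilon> = snd (w ! j);
          x = act (word_subst G \<rho> (take j w @ [(s, if \<epsilon> = 1 then 0 else -1)])) (c s)
      in if \<epsilon> = 1 then x else - x)"

context banach_lie_group
begin

text \<open>
  By the product rule, prepending a letter adds the term of this letter and applies the adjoint action
  of its value to the other terms; this lengthens the prefix in every Fox term by that letter.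
\<close>

lemma has_log_deriv_word:
  fixes H :: "'f \<Rightarrow> 'a::real_normed_vector \<Rightarrow> 'g"
  assumes w: "w \<in> lists (S \<times> {1, -1})"
    and H: "\<And>s. s \<in> S \<Longrightarrow> has_log_deriv (H s) y (\<lambda>v. D v s)"
    and \<rho>: "\<And>s. s \<in> S \<Longrightarrow> H s y = \<rho> s"
  shows "has_log_deriv (\<lambda>z. word_subst G (\<lambda>s. H s z) w) y (\<lambda>v. \<Sum>j<length w. fox_term G \<rho> adj w (D v) j)"
  using w
proof (induction w rule: list.induct)
  case Nil
  then show ?case using has_log_deriv_const[OF one_closed] by simp
next
  case (Cons p w)
  obtain s \<epsilon> where p: "p = (s, \<epsilon>)" by fastforce
  have s: "s \<in> S" and \<epsilon>: "\<epsilon> = 1 \<or> \<epsilon> = -1" and w: "w \<in> lists (S \<times> {1, -1})"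
    using Cons.prems p by auto
  have cl: "\<rho> u \<in> carrier G" if "u \<in> S" for u
    using has_log_deriv_closed[OF H[OF that], of y] \<rho>[OF that] by simp
  have Hcl: "H s z \<in> carrier G" for z by (rule has_log_deriv_closed[OF H[OF s]])
  have neg: "x [^] (-1 :: int) = inv x" if "x \<in> carrier G" for x
    using int_pow_neg[OF that, of 1] that by simp
  have letter: "has_log_deriv (\<lambda>z. H s z [^] \<epsilon>) y (\<lambda>v. fox_term G \<rho> adj (p # w) (D v) 0)"
  proof (cases "\<epsilon> = 1")
    case True
    then show ?thesis using H[OF s] Hcl cl[OF s] by (simp add: fox_term_def p adj_one)
  next
    case False
    with \<epsilon> have \<epsilon>: "\<epsilon> = -1" by simp
    show ?thesis
      using has_log_deriv_inv[OF H[OF s]] Hcl cl[OF s] \<rho>[OF s] by (simp add: fox_term_def p \<epsilon> neg)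
  qed
  have a: "\<rho> s [^] \<epsilon> \<in> carrier G" using cl[OF s] by simp
  interpret ad: bounded_linear "adj (\<rho> s [^] \<epsilon>)" using a by (rule bounded_linear_adj)
  have shift: "fox_term G \<rho> adj (p # w) c (Suc j) = adj (\<rho> s [^] \<epsilon>) (fox_term G \<rho> adj w c j)"
    if j: "j < length w" for c j
  proof -
    have "fst ` set (take j w @ [(fst (w ! j), e)]) \<subseteq> S" for e
      using w nth_mem[OF j] by (fastforce simp: in_lists_conv_set dest: in_set_takeD)
    then have "word_subst G \<rho> (take j w @ [(fst (w ! j), e)]) \<in> carrier G" for e
      using cl by (intro word_subst_closed) blast
    then show ?thesis
      using a by (simp add: fox_term_def p Let_def adj_mult ad.neg)
  qed
  have "has_log_deriv (\<lambda>z. H s z [^] \<epsilon> \<otimes> word_subst G (\<lambda>s. H s z) w) y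
      (\<lambda>v. fox_term G \<rho> adj (p # w) (D v) 0
         + adj (\<rho> s [^] \<epsilon>) (\<Sum>j<length w. fox_term G \<rho> adj w (D v) j))"
    using has_log_deriv_mult[OF letter Cons.IH] w \<rho>[OF s] by simp
  moreover have "fox_term G \<rho> adj (p # w) c 0 + adj (\<rho> s [^] \<epsilon>) (\<Sum>j<length w. fox_term G \<rho> adj w c j)
      = (\<Sum>j<length (p # w). fox_term G \<rho> adj (p # w) c j)" for c
    by (simp add: sum.lessThan_Suc_shift ad.sum shift del: sum.lessThan_Suc)
  ultimately show ?case by (simp add: p)
qed

lemma lie_algebra_outside:
  "v \<in> lie_algebra G A \<Longrightarrow> c \<notin> charts_at A \<one> \<Longrightarrow> v c = 0"
  unfolding tangent_space_def by blast

lemma lie_algebra_transition: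
  assumes "v \<in> lie_algebra G A" "c \<in> charts_at A \<one>" "d \<in> charts_at A \<one>"
  shows "frechet_derivative (local_rep c d id) (at (snd c \<one>)) (v c) = v d"
  using assms unfolding tangent_space_def by fastforce

lemma lie_algebra_add:
  assumes "v \<in> lie_algebra G A" "w \<in> lie_algebra G A"
  shows "v + w \<in> lie_algebra G A"
  unfolding tangent_space_def
proof (intro CollectI conjI allI impI ballI)
  show "(v + w) c = 0" if "c \<notin> charts_at A \<one>" for c
    using that assms by (simp add: lie_algebra_outside)
  fix c d assume c: "c \<in> charts_at A \<one>" and d: "d \<in> charts_at A \<one>"
  have "linear (frechet_derivative (local_rep c d id) (at (snd c \<one>)))"
    using transition_has_derivative[OF manifold c d] by (rule has_derivative_linear)
  with assms c d show "(v + w) d = frechet_derivative (local_rep c d id) (at (snd c \<one>)) ((v + w) c)"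
    by (simp add: lie_algebra_transition linear_add)
qed

lemma lie_algebra_uminus:
  assumes "v \<in> lie_algebra G A"
  shows "- v \<in> lie_algebra G A"
  unfolding tangent_space_def
proof (intro CollectI conjI allI impI ballI)
  show "(- v) c = 0" if "c \<notin> charts_at A \<one>" for c
    using that assms by (simp add: lie_algebra_outside)
  fix c d assume c: "c \<in> charts_at A \<one>" and d: "d \<in> charts_at A \<one>"
  have "linear (frechet_derivative (local_rep c d id) (at (snd c \<one>)))"
    using transition_has_derivative[OF manifold c d] by (rule has_derivative_linear)
  with assms c d show "(- v) d = frechet_derivative (local_rep c d id) (at (snd c \<one>)) ((- v) c)"
    by (simp add: lie_algebra_transition linear_neg)
qed

lemma lie_algebra_zero: "0 \<in> lie_algebra G A"
  unfolding tangent_space_def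
proof (intro CollectI conjI allI impI ballI)
  fix c d assume c: "c \<in> charts_at A \<one>" and d: "d \<in> charts_at A \<one>"
  have "linear (frechet_derivative (local_rep c d id) (at (snd c \<one>)))"
    using transition_has_derivative[OF manifold c d] by (rule has_derivative_linear)
  then show "(0 :: ('g, 'e) chart \<Rightarrow> 'e) d
      = frechet_derivative (local_rep c d id) (at (snd c \<one>)) ((0 :: ('g, 'e) chart \<Rightarrow> 'e) c)"
    by (simp add: linear_0)
qed simp

lemma lie_algebra_sum: "(\<And>j. j \<in> J \<Longrightarrow> v j \<in> lie_algebra G A) \<Longrightarrow> sum v J \<in> lie_algebra G A"
  by (induction J rule: infinite_finite_induct) (auto intro: lie_algebra_add simp: lie_algebra_zero)

text \<open>
  The tangent vector at \<open>\<one>\<close> with a given coordinate in \<open>chart_one\<close>; it identifies the model space with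
  the Lie algebra.
\<close>

definition tangent_vector :: "'e \<Rightarrow> ('g, 'e) chart \<Rightarrow> 'e" where
  "tangent_vector = (SOME g. homeomorphic_maps (lie_algebra_topology G A) euclidean (\<lambda>v. v chart_one) g)"

lemma tangent_vector_homeomorphic:
  "homeomorphic_maps (lie_algebra_topology G A) euclidean (\<lambda>v. v chart_one) tangent_vector"
  unfolding tangent_vector_def
  using tangent_coordinate_homeomorphic[OF manifold chart_one]
  unfolding homeomorphic_map_maps by (rule someI_ex)

lemma topspace_lie_algebra: "topspace (lie_algebra_topology G A) = lie_algebra G A"
  by (simp add: tangent_topology_def)

lemma continuous_tangent_vector: "continuous_map euclidean (lie_algebra_topology G A) tangent_vector"
  using tangent_vector_homeomorphic by (simp add: homeomorphic_maps_def)

lemma tangent_vector_in: "tangent_vector x \<in> lie_algebra G A"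
  using continuous_tangent_vector topspace_lie_algebra by (fastforce simp: continuous_map_def)

lemma tangent_vector_chart_one [simp]: "tangent_vector x chart_one = x"
  using tangent_vector_homeomorphic by (simp add: homeomorphic_maps_def)

lemma tangent_vector_coordinate: "v \<in> lie_algebra G A \<Longrightarrow> tangent_vector (v chart_one) = v"
  using tangent_vector_homeomorphic topspace_lie_algebra by (auto simp: homeomorphic_maps_def)

lemma lie_algebra_eqI:
  "v \<in> lie_algebra G A \<Longrightarrow> w \<in> lie_algebra G A \<Longrightarrow> v chart_one = w chart_one \<Longrightarrow> v = w"
  using tangent_vector_coordinate by metis

end


section \<open>Local rigidity\<close>

locale lie_group_representation =
  banach_lie_group G X A + presentation R F \<Gamma> \<iota> \<pi> T S
  for G :: "('g, 'm) monoid_scheme" (structure) and X :: "'g topology"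
    and A :: "('g, 'e::banach) chart set"
    and R :: "('t, 'k) monoid_scheme" and F :: "('f, 'l) monoid_scheme"
    and \<Gamma> :: "('c, 'n) monoid_scheme"
    and \<iota> :: "'t \<Rightarrow> 'f" and \<pi> :: "'f \<Rightarrow> 'c" and T :: "'t set" and S :: "'f set" +
  fixes r :: "'c \<Rightarrow> 'g"
  assumes r: "r \<in> Hom \<Gamma> G"
begin

abbreviation \<rho> :: "'f \<Rightarrow> 'g" where "\<rho> s \<equiv> r (\<pi> s)"

abbreviation act :: "'c \<Rightarrow> (('g, 'e) chart \<Rightarrow> 'e) \<Rightarrow> ('g, 'e) chart \<Rightarrow> 'e" where
  "act \<gamma> \<equiv> Ad G A (r \<gamma>)"

abbreviation relator :: "'t \<Rightarrow> ('f \<times> int) list" where "relator t \<equiv> reduced_word F S (\<iota> t)"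

lemma group_F: "group F" and S_subset: "S \<subseteq> carrier F"
  and bij_word_val: "bij_betw (word_val F) (reduced_words S) (carrier F)"
  using free_F by (auto simp: free_on_def)

lemma r_hom: "r \<in> hom \<Gamma> G"
  using r by (simp add: Hom_def)

lemma \<pi>_hom: "\<pi> \<in> hom F \<Gamma>" and \<pi>_surj: "\<pi> ` carrier F = carrier \<Gamma>"
  using \<pi>_epi by (auto simp: epi_def)

lemma \<pi>_closed: "x \<in> carrier F \<Longrightarrow> \<pi> x \<in> carrier \<Gamma>"
  using \<pi>_surj by blast

lemma \<rho>_closed: "x \<in> carrier F \<Longrightarrow> \<rho> x \<in> carrier G"
  using \<pi>_closed r_hom by (blast intro: hom_in_carrier)

lemma reduced_wordsD: "w \<in> reduced_words S \<Longrightarrow> w \<in> lists (S \<times> {1, -1})"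
  by (simp add: reduced_words_def)

lemma letters: "w \<in> lists (S \<times> {1, -1}) \<Longrightarrow> fst ` set w \<subseteq> S"
  by (fastforce simp: in_lists_conv_set)

text \<open>
  Relators have trivial image in \<open>\<Gamma>\<close>. With \<open>hom_relator\<close> below this is what makes the values of any
  homomorphism on the generators a solution of the relations.
\<close>

lemma \<iota>_in_kernel: "t \<in> T \<Longrightarrow> \<iota> t \<in> carrier F \<and> \<pi> (\<iota> t) = \<one>\<^bsub>\<Gamma>\<^esub>"
  using free_R exact by (fastforce simp: free_on_def kernel_def)

lemma relator:
  assumes "t \<in> T"
  shows "relator t \<in> reduced_words S" "word_val F (relator t) = \<iota> t"
proof -
  have "\<exists>!w. w \<in> reduced_words S \<and> word_val F w = \<iota> t"
  proof -
    have "\<iota> t \<in> word_val F ` reduced_words S" and inj: "inj_on (word_val F) (reduced_words S)"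
      using bij_word_val \<iota>_in_kernel[OF assms] by (auto simp: bij_betw_def)
    then obtain w where "w \<in> reduced_words S" "word_val F w = \<iota> t" by auto
    then show ?thesis using inj by (intro ex1I[of _ w]) (auto simp: inj_on_def)
  qed
  from theI'[OF this] show "relator t \<in> reduced_words S" "word_val F (relator t) = \<iota> t"
    by (simp_all add: reduced_word_def)
qed

lemma relator_letters: "t \<in> T \<Longrightarrow> s \<in> fst ` set (relator t) \<Longrightarrow> s \<in> S"
  using relator(1) reduced_wordsD letters by blast

lemma hom_word_subst:
  assumes \<phi>: "\<phi> \<in> hom \<Gamma> G" and w: "w \<in> lists (S \<times> {1, -1})" and h: "\<And>s. s \<in> S \<Longrightarrow> h s = \<phi> (\<pi> s)"
  shows "word_subst G h w = \<phi> (\<pi> (word_val F w))"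
proof -
  have "(\<lambda>x. \<phi> (\<pi> x)) \<in> hom F G" using Group.hom_compose[OF \<pi>_hom \<phi>] by (simp add: o_def)
  from hom_word_val[OF group_F is_group this, of w] have
    "\<phi> (\<pi> (word_val F w)) = word_subst G (\<lambda>x. \<phi> (\<pi> x)) w"
    using letters[OF w] S_subset by blast
  also have "\<dots> = word_subst G h w"
    by (rule word_subst_cong) (use h letters[OF w] in auto)
  finally show ?thesis by simp
qed

lemma hom_relator:
  assumes "\<phi> \<in> hom \<Gamma> G" "t \<in> T" "\<And>s. s \<in> S \<Longrightarrow> h s = \<phi> (\<pi> s)"
  shows "word_subst G h (relator t) = \<one>"
  using hom_word_subst[OF assms(1) reduced_wordsD[OF relator(1)[OF assms(2)]] assms(3)]
    relator(2) \<iota>_in_kernel assms hom_one[OF assms(1) group_\<Gamma> is_group] by simp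

lemma homs_eq_on_generators:
  assumes \<phi>: "\<phi> \<in> hom \<Gamma> G" and \<psi>: "\<psi> \<in> hom \<Gamma> G" and eq: "\<And>s. s \<in> S \<Longrightarrow> \<phi> (\<pi> s) = \<psi> (\<pi> s)"
    and \<gamma>: "\<gamma> \<in> carrier \<Gamma>"
  shows "\<phi> \<gamma> = \<psi> \<gamma>"
proof -
  obtain x where x: "x \<in> carrier F" "\<gamma> = \<pi> x" using \<gamma> \<pi>_surj by blast
  obtain w where w: "w \<in> reduced_words S" "x = word_val F w"
    using x(1) bij_word_val by (auto simp: bij_betw_def)
  have "\<phi> \<gamma> = word_subst G (\<lambda>s. \<phi> (\<pi> s)) w"
    using hom_word_subst[OF \<phi> reduced_wordsD[OF w(1)]] x w by simp
  also have "\<dots> = \<psi> \<gamma>"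
    using hom_word_subst[OF \<psi> reduced_wordsD[OF w(1)], of "\<lambda>s. \<phi> (\<pi> s)"] eq x w by simp
  finally show ?thesis .
qed

lemma conj_hom: "p \<in> carrier G \<Longrightarrow> (\<lambda>\<gamma>. p \<otimes> r \<gamma> \<otimes> inv p) \<in> hom \<Gamma> G"
proof (rule homI)
  fix x y assume p: "p \<in> carrier G" and x: "x \<in> carrier \<Gamma>" and y: "y \<in> carrier \<Gamma>"
  have "r x \<in> carrier G" "r y \<in> carrier G" "r (x \<otimes>\<^bsub>\<Gamma>\<^esub> y) = r x \<otimes> r y"
    using x y r_hom by (auto simp: hom_def)
  then show "p \<otimes> r (x \<otimes>\<^bsub>\<Gamma>\<^esub> y) \<otimes> inv p = (p \<otimes> r x \<otimes> inv p) \<otimes> (p \<otimes> r y \<otimes> inv p)"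
    using p by (simp add: m_assoc flip: m_assoc[of "inv p" p])
qed (use r_hom hom_in_carrier in \<open>fastforce\<close>)


subsection \<open>The two maps and their derivatives\<close>

text \<open>
  A family of generator values near \<open>\<rho>\<close> is encoded by the coordinates of the quotients of its members
  by \<open>\<rho> s\<close>. In this encoding, \<open>\<rho>\<close> itself is the constant family \<open>origin\<close>, and the family \<open>y\<close> assigns
  \<open>param (entry y s) \<otimes> \<rho> s\<close> to \<open>s\<close>.
\<close>

definition conjugates :: "'e \<Rightarrow> 'f discrete \<Rightarrow>\<^sub>C 'e" where
  "conjugates x = family S (\<lambda>s. coord (param x \<otimes> \<rho> s \<otimes> inv (param x) \<otimes> inv (\<rho> s)))"

definition relations :: "'t \<Rightarrow> ('f discrete \<Rightarrow>\<^sub>C 'e) \<Rightarrow> 'e" where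
  "relations t y = coord (word_subst G (\<lambda>s. param (entry y s) \<otimes> \<rho> s) (relator t))"

text \<open>
  The operators \<open>\<delta>\<^sup>0\<close> and \<open>\<delta>\<^sup>1\<close>, with the Lie algebra identified with the model space by \<open>chart_one\<close>.
\<close>

definition coord_delta0 :: "'e \<Rightarrow> 'f discrete \<Rightarrow>\<^sub>C 'e" where
  "coord_delta0 v = family S (\<lambda>s. v - adj (\<rho> s) v)"

definition coord_delta1 :: "('f discrete \<Rightarrow>\<^sub>C 'e) \<Rightarrow> 't \<Rightarrow> 'e" where
  "coord_delta1 y t = (\<Sum>j<length (relator t). fox_term G \<rho> adj (relator t) (entry y) j)"

lemma conjugates_origin: "conjugates origin = family S (\<lambda>s. origin)"
  unfolding conjugates_def using \<rho>_closed S_subset finite_S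
  by (intro entry_eqI) (auto simp: entry_family subset_iff)

lemma conjugate_has_log_deriv:
  assumes "s \<in> S"
  shows "has_log_deriv (\<lambda>x. param x \<otimes> \<rho> s \<otimes> inv (param x)) origin (\<lambda>v. v - adj (\<rho> s) v)"
proof -
  have s: "\<rho> s \<in> carrier G" using assms S_subset \<rho>_closed by blast
  interpret bounded_linear "adj (\<rho> s)" using s by (rule bounded_linear_adj)
  show ?thesis
    using has_log_deriv_mult[OF has_log_deriv_mult[OF has_log_deriv_param has_log_deriv_const[OF s]]
        has_log_deriv_inv[OF has_log_deriv_param]] s
    by (simp add: adj_one neg)
qed

lemma conjugate_has_chart_deriv:
  assumes "s \<in> S"
  shows "has_chart_deriv A (\<lambda>x. param x \<otimes> \<rho> s \<otimes> inv (param x) \<otimes> inv (\<rho> s)) origin chart_one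
    (\<lambda>v. v - adj (\<rho> s) v)"
  using conjugate_has_log_deriv[OF assms] assms S_subset \<rho>_closed
  by (auto simp: has_log_deriv_def subset_iff)

lemma conjugates_strict_deriv: "strict_deriv conjugates coord_delta0 origin"
  using strict_deriv_family[OF finite_S, of "\<lambda>s x. coord (param x \<otimes> \<rho> s \<otimes> inv (param x) \<otimes> inv (\<rho> s))"
      "\<lambda>s v. v - adj (\<rho> s) v" origin] conjugate_has_chart_deriv
  unfolding conjugates_def[abs_def] coord_delta0_def[abs_def] has_chart_deriv_def by blast

lemma eventually_conjugates_near_one:
  "\<forall>\<^sub>F x in nhds origin. \<forall>s\<in>S. param x \<otimes> \<rho> s \<otimes> inv (param x) \<otimes> inv (\<rho> s) \<in> fst chart_one"
  using conjugate_has_chart_deriv finite_S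
  by (intro eventually_ball_finite) (auto simp: has_chart_deriv_def)

text \<open>
  A conjugate of \<open>r\<close> is a homomorphism, so it satisfies all relations. The neighbourhood on which this
  holds does not depend on \<open>t\<close>, as only the generators have to stay in the chart.
\<close>

lemma relations_conjugates:
  assumes near: "\<forall>s\<in>S. param x \<otimes> \<rho> s \<otimes> inv (param x) \<otimes> inv (\<rho> s) \<in> fst chart_one" and t: "t \<in> T"
  shows "relations t (conjugates x) = origin"
proof -
  have "param (entry (conjugates x) s) \<otimes> \<rho> s = param x \<otimes> \<rho> s \<otimes> inv (param x)" if s: "s \<in> S" for s
  proof -
    have "\<rho> s \<in> carrier G" using s S_subset \<rho>_closed by blast
    moreover have "param (entry (conjugates x) s) = param x \<otimes> \<rho> s \<otimes> inv (param x) \<otimes> inv (\<rho> s)"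
      using near s finite_S by (simp add: conjugates_def entry_family param_coord)
    ultimately show ?thesis by (simp add: m_assoc)
  qed
  then have "word_subst G (\<lambda>s. param (entry (conjugates x) s) \<otimes> \<rho> s) (relator t) = \<one>"
    by (intro hom_relator[OF conj_hom[OF param_closed[of x]] t])
  then show ?thesis by (simp add: relations_def)
qed

lemma relations_strict_deriv:
  assumes t: "t \<in> T"
  shows "strict_deriv (relations t) (\<lambda>y. coord_delta1 y t) (conjugates origin)"
proof -
  have letter: "has_log_deriv (\<lambda>y. param (entry y s) \<otimes> \<rho> s) (conjugates origin) (\<lambda>v. entry v s)"
    and val: "param (entry (conjugates origin) s) \<otimes> \<rho> s = \<rho> s" if s: "s \<in> S" for s
  proof -
    have \<rho>: "\<rho> s \<in> carrier G" using s S_subset \<rho>_closed by blast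
    have y0: "entry (conjugates origin) s = origin"
      using s finite_S by (simp add: conjugates_origin entry_family)
    then show "param (entry (conjugates origin) s) \<otimes> \<rho> s = \<rho> s" using \<rho> by simp
    have "has_log_deriv (\<lambda>y. param (entry y s)) (conjugates origin) (\<lambda>v. entry v s)"
      by (rule has_log_deriv_reparam[where L = "\<lambda>v. v"])
        (simp_all add: y0 has_log_deriv_param strict_deriv_bounded_linear_self bounded_linear_entry)
    from has_log_deriv_mult[OF this has_log_deriv_const[OF \<rho>]]
    show "has_log_deriv (\<lambda>y. param (entry y s) \<otimes> \<rho> s) (conjugates origin) (\<lambda>v. entry v s)"
      by (simp add: y0 adj_one)
  qed
  have "has_log_deriv (\<lambda>y. word_subst G (\<lambda>s. param (entry y s) \<otimes> \<rho> s) (relator t)) (conjugates origin)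
      (\<lambda>v. coord_delta1 v t)"
    unfolding coord_delta1_def
    by (rule has_log_deriv_word[OF reduced_wordsD[OF relator(1)[OF t]] letter val])
  moreover have "word_subst G (\<lambda>s. param (entry (conjugates origin) s) \<otimes> \<rho> s) (relator t) = \<one>"
    by (rule hom_relator[OF r_hom t val])
  moreover have "word_subst G (\<lambda>s. param (entry y s) \<otimes> \<rho> s) (relator t) \<in> carrier G" for y
    using calculation(1) by (rule has_log_deriv_closed)
  ultimately have "has_chart_deriv A
      (\<lambda>y. word_subst G (\<lambda>s. param (entry y s) \<otimes> \<rho> s) (relator t)) (conjugates origin) chart_one (\<lambda>v. coord_delta1 v t)"
    by (simp add: has_log_deriv_def)
  then show ?thesis unfolding relations_def[abs_def] by (simp add: has_chart_deriv_def)
qed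


subsection \<open>The coboundary operators in coordinates\<close>

lemma sum_fun_apply: "(\<Sum>j\<in>J. f j) x = (\<Sum>j\<in>J. f j x)"
  for f :: "'i \<Rightarrow> 'a \<Rightarrow> 'b::ab_group_add"
  by (induction J rule: infinite_finite_induct) auto

lemma delta1_eq_sum:
  assumes t: "t \<in> T"
  shows "delta1 F \<iota> \<pi> T S act c t = (\<Sum>j<length (relator t). fox_term G \<rho> (Ad G A) (relator t) c j)"
  unfolding delta1_def restrict_apply Let_def using t
proof (simp, intro sum.cong refl)
  fix j assume "j \<in> {..<length (relator t)}"
  then have j: "j < length (relator t)" by simp
  let ?w = "relator t"
  have S: "fst ` set (take j ?w @ [(fst (?w ! j), e)]) \<subseteq> S" for e
    using relator_letters[OF t] nth_mem[OF j] by (fastforce dest: in_set_takeD)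
  have "(\<lambda>x. r (\<pi> x)) \<in> hom F G" using Group.hom_compose[OF \<pi>_hom r_hom] by (simp add: o_def)
  from hom_word_val[OF group_F is_group this, of "take j ?w @ [(fst (?w ! j), e)]" for e] S S_subset
  have "\<rho> (word_val F (take j ?w @ [(fst (?w ! j), e)])) = word_subst G \<rho> (take j ?w @ [(fst (?w ! j), e)])" for e
    by blast
  then show "(if snd (?w ! j) = 1
      then act (\<pi> (word_val F (take j ?w @ [(fst (?w ! j), if snd (?w ! j) = 1 then 0 else - 1)]))) (c (fst (?w ! j)))
      else - act (\<pi> (word_val F (take j ?w @ [(fst (?w ! j), if snd (?w ! j) = 1 then 0 else - 1)]))) (c (fst (?w ! j))))
      = fox_term G \<rho> (Ad G A) ?w c j"
    by (simp add: fox_term_def Let_def)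
qed

lemma relator_prefix_closed:
  assumes t: "t \<in> T" and j: "j < length (relator t)"
  shows "word_subst G \<rho> (take j (relator t) @ [(fst (relator t ! j), e)]) \<in> carrier G"
proof (rule word_subst_closed)
  fix s assume "s \<in> fst ` set (take j (relator t) @ [(fst (relator t ! j), e)])"
  then have "s \<in> S" using relator_letters[OF t] nth_mem[OF j] by (fastforce dest: in_set_takeD)
  then show "\<rho> s \<in> carrier G" using S_subset \<rho>_closed by blast
qed

lemma delta1_in_lie_algebra: "t \<in> T \<Longrightarrow> delta1 F \<iota> \<pi> T S act c t \<in> lie_algebra G A"
  unfolding delta1_eq_sum
  by (intro lie_algebra_sum)
    (auto simp: fox_term_def Let_def intro!: lie_algebra_uminus Ad_in_lie_algebra relator_prefix_closed)

lemma delta1_chart_one: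
  assumes t: "t \<in> T" and c: "\<And>s. s \<in> S \<Longrightarrow> c s chart_one = entry y s"
  shows "delta1 F \<iota> \<pi> T S act c t chart_one = coord_delta1 y t"
proof -
  have "fox_term G \<rho> (Ad G A) (relator t) c j chart_one = fox_term G \<rho> adj (relator t) (entry y) j"
    if j: "j < length (relator t)" for j
  proof -
    have "fst (relator t ! j) \<in> S" using relator_letters[OF t] nth_mem[OF j] by blast
    then show ?thesis
      using relator_prefix_closed[OF t j] c by (simp add: fox_term_def Let_def Ad_chart_one)
  qed
  then show ?thesis by (simp add: delta1_eq_sum[OF t] coord_delta1_def sum_fun_apply)
qed

text \<open>
  The set of coboundaries contains the zero cochain. Hence a cocycle lies in its own coset modulo the
  coboundaries, and it is a coboundary if this coset is the trivial one.
\<close>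

lemma delta0_zero: "delta0 \<pi> S act 0 = (\<lambda>s\<in>S. 0)"
proof
  fix s
  have "Ad G A (\<rho> s) 0 = 0" if "s \<in> S"
  proof (rule lie_algebra_eqI)
    have "\<rho> s \<in> carrier G" using that S_subset \<rho>_closed by blast
    then show "Ad G A (\<rho> s) 0 \<in> lie_algebra G A" "Ad G A (\<rho> s) 0 chart_one = 0 chart_one"
      by (simp_all add: Ad_in_lie_algebra Ad_chart_one linear_0[OF bounded_linear.linear[OF bounded_linear_adj]])
  qed (rule lie_algebra_zero)
  then show "delta0 \<pi> S act 0 s = (\<lambda>s\<in>S. 0) s" by (simp add: delta0_def)
qed

lemma trivial_H1_imp_coboundary:
  assumes H1: "carrier (H1 F \<iota> \<pi> T S (lie_algebra G A) act) = {\<one>\<^bsub>H1 F \<iota> \<pi> T S (lie_algebra G A) act\<^esub>}"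
    and c: "c \<in> S \<rightarrow>\<^sub>E lie_algebra G A" and cocycle: "delta1 F \<iota> \<pi> T S act c = (\<lambda>t\<in>T. 0)"
  obtains v where "v \<in> lie_algebra G A" "c = delta0 \<pi> S act v"
proof -
  let ?B = "delta0 \<pi> S act ` lie_algebra G A"
  let ?M = "Map_group S (lie_algebra G A)"
  let ?Z = "?M\<lparr>carrier := kernel ?M (Map_group T (lie_algebra G A)) (delta1 F \<iota> \<pi> T S act)\<rparr>"
  have "c \<in> carrier ?Z" using c cocycle by (simp add: kernel_def Map_group_def)
  then have "?B #>\<^bsub>?Z\<^esub> c \<in> carrier (H1 F \<iota> \<pi> T S (lie_algebra G A) act)"
    unfolding H1_def FactGroup_def RCOSETS_def by auto
  then have "?B #>\<^bsub>?Z\<^esub> c = \<one>\<^bsub>H1 F \<iota> \<pi> T S (lie_algebra G A) act\<^esub>" using H1 by blast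
  then have coset: "?B #>\<^bsub>?Z\<^esub> c = ?B" by (simp add: H1_def FactGroup_def)
  have "(\<lambda>s\<in>S. 0) \<in> ?B" using delta0_zero lie_algebra_zero by (metis imageI)
  then have "(\<lambda>s\<in>S. 0) \<otimes>\<^bsub>?Z\<^esub> c \<in> ?B #>\<^bsub>?Z\<^esub> c" by (auto simp: r_coset_def)
  moreover have "(\<lambda>s\<in>S. 0) \<otimes>\<^bsub>?Z\<^esub> c = c"
    using c by (auto simp: Map_group_def fun_eq_iff PiE_iff extensional_def)
  ultimately have "c \<in> ?B" using coset by simp
  with that show ?thesis by blast
qed

definition cochain :: "('f discrete \<Rightarrow>\<^sub>C 'e) \<Rightarrow> 'f \<Rightarrow> ('g, 'e) chart \<Rightarrow> 'e" where
  "cochain y = (\<lambda>s\<in>S. tangent_vector (entry y s))"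

lemma cochain_in: "cochain y \<in> S \<rightarrow>\<^sub>E lie_algebra G A"
  by (simp add: cochain_def tangent_vector_in)

lemma delta1_cochain: "t \<in> T \<Longrightarrow> delta1 F \<iota> \<pi> T S act (cochain y) t = tangent_vector (coord_delta1 y t)"
  by (rule lie_algebra_eqI)
    (simp_all add: delta1_in_lie_algebra tangent_vector_in delta1_chart_one cochain_def)

lemma coord_delta1_exact:
  assumes H1: "carrier (H1 F \<iota> \<pi> T S (lie_algebra G A) act) = {\<one>\<^bsub>H1 F \<iota> \<pi> T S (lie_algebra G A) act\<^esub>}"
    and y: "y \<in> families S" and cocycle: "\<forall>t\<in>T. coord_delta1 y t = 0"
  shows "\<exists>v. coord_delta0 v = y"
proof -
  have zero: "tangent_vector 0 = 0"
    using tangent_vector_coordinate[OF lie_algebra_zero] by simp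
  have "delta1 F \<iota> \<pi> T S act (cochain y) = (\<lambda>t\<in>T. 0)"
  proof
    fix t show "delta1 F \<iota> \<pi> T S act (cochain y) t = (\<lambda>t\<in>T. 0) t"
      using cocycle by (cases "t \<in> T") (simp_all add: delta1_cochain zero, simp add: delta1_def)
  qed
  from trivial_H1_imp_coboundary[OF H1 cochain_in this] obtain v where
    v: "cochain y = delta0 \<pi> S act v" by blast
  have "coord_delta0 (v chart_one) = y"
  proof (rule entry_eqI)
    fix s
    show "entry (coord_delta0 (v chart_one)) s = entry y s"
    proof (cases "s \<in> S")
      case True
      have "\<rho> s \<in> carrier G" using True S_subset \<rho>_closed by blast
      moreover have "cochain y s chart_one = delta0 \<pi> S act v s chart_one" using v by simp
      ultimately show ?thesis
        using True finite_S by (simp add: coord_delta0_def entry_family cochain_def delta0_def Ad_chart_one)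
    qed (use y finite_S in \<open>simp add: coord_delta0_def entry_family families_def\<close>)
  qed
  then show ?thesis ..
qed

text \<open>
  The image in coordinates is the preimage of the image of \<open>\<delta>\<^sup>1\<close> under the map that turns coordinates
  into tangent vectors, which is continuous.
\<close>

lemma coord_delta1_closed_image:
  assumes cl: "closedin (product_topology (\<lambda>_. lie_algebra_topology G A) T)
    (delta1 F \<iota> \<pi> T S act ` (S \<rightarrow>\<^sub>E lie_algebra G A))"
  shows "closedin (product_topology (\<lambda>_. euclidean) T) ((\<lambda>y. restrict (coord_delta1 y) T) ` families S)"
proof -
  let ?P = "product_topology (\<lambda>_. euclidean :: 'e topology) T"
  let ?\<Phi> = "\<lambda>z. \<lambda>t\<in>T. tangent_vector (z t)"
  have "continuous_map ?P (product_topology (\<lambda>_. lie_algebra_topology G A) T) ?\<Phi>"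
    unfolding continuous_map_componentwise
  proof (intro conjI ballI)
    fix t assume t: "t \<in> T"
    have "continuous_map ?P (lie_algebra_topology G A) (tangent_vector \<circ> (\<lambda>z. z t))"
      by (rule continuous_map_compose[OF continuous_map_product_projection[OF t] continuous_tangent_vector])
    with t show "continuous_map ?P (lie_algebra_topology G A) (\<lambda>z. ?\<Phi> z t)" by (simp add: o_def)
  qed auto
  from closedin_continuous_map_preimage[OF this cl]
  have "closedin ?P {z \<in> topspace ?P. ?\<Phi> z \<in> delta1 F \<iota> \<pi> T S act ` (S \<rightarrow>\<^sub>E lie_algebra G A)}" .
  also have "{z \<in> topspace ?P. ?\<Phi> z \<in> delta1 F \<iota> \<pi> T S act ` (S \<rightarrow>\<^sub>E lie_algebra G A)}
      = (\<lambda>y. restrict (coord_delta1 y) T) ` families S" (is "?L = ?R")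
  proof (intro equalityI subsetI)
    fix z assume z: "z \<in> ?L"
    then obtain c where c: "c \<in> S \<rightarrow>\<^sub>E lie_algebra G A" "?\<Phi> z = delta1 F \<iota> \<pi> T S act c" by blast
    define y where "y = family S (\<lambda>s. c s chart_one)"
    have y: "c s chart_one = entry y s" if "s \<in> S" for s
      using that finite_S by (simp add: y_def entry_family)
    have "z t = coord_delta1 y t" if t: "t \<in> T" for t
    proof -
      have "?\<Phi> z t chart_one = delta1 F \<iota> \<pi> T S act c t chart_one" using c(2) by simp
      then show ?thesis using t y delta1_chart_one[OF t, of c y] by simp
    qed
    then have "z = restrict (coord_delta1 y) T"
      using z by (auto simp: fun_eq_iff PiE_iff extensional_def)
    then show "z \<in> ?R" using family_in_families[OF finite_S] y_def by blast
  next
    fix z assume "z \<in> ?R"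
    then obtain y where y: "z = restrict (coord_delta1 y) T" by blast
    have "?\<Phi> z = delta1 F \<iota> \<pi> T S act (cochain y)"
    proof
      fix t show "?\<Phi> z t = delta1 F \<iota> \<pi> T S act (cochain y) t"
        by (cases "t \<in> T") (simp_all add: y delta1_cochain, simp add: delta1_def)
    qed
    then show "z \<in> ?L" using cochain_in y by auto
  qed
  finally show ?thesis .
qed


subsection \<open>Neighbourhoods of the representation\<close>

lemma openin_near_element:
  assumes a: "a \<in> carrier G"
  shows "openin X {p \<in> carrier G. p \<otimes> inv a \<in> fst chart_one \<and> norm (coord (p \<otimes> inv a) - origin) < e}"
proof -
  let ?W = "{q \<in> topspace (subtopology X (fst chart_one)). coord q \<in> ball origin e}"
  have op: "openin X (fst chart_one)" and
    "homeomorphic_map (subtopology X (fst chart_one)) (top_of_set (coord ` fst chart_one)) coord"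
    using manifold chart_one_mem(1) by (auto simp: banach_manifold_def)
  then have "continuous_map (subtopology X (fst chart_one)) (top_of_set (coord ` fst chart_one)) coord"
    by (simp add: homeomorphic_imp_continuous_map)
  then have "continuous_map (subtopology X (fst chart_one)) euclidean coord"
    by (rule continuous_map_into_fulltopology)
  from openin_continuous_map_preimage[OF this, of "ball origin e"]
  have "openin (subtopology X (fst chart_one)) ?W" by simp
  then have W: "openin X ?W" using op openin_trans_full by blast
  have "continuous_map (prod_topology X X) X (\<lambda>(x, y). x \<otimes> y)"
    using smooth_mult by (simp add: smooth_map_def)
  moreover have "continuous_map X (prod_topology X X) (\<lambda>p. (p, inv a))"
    using a topspace_eq_carrier by (intro continuous_map_pairedI) auto
  ultimately have "continuous_map X X ((\<lambda>(x, y). x \<otimes> y) \<circ> (\<lambda>p. (p, inv a)))"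
    by (rule continuous_map_compose[rotated])
  then have "continuous_map X X (\<lambda>p. p \<otimes> inv a)" by (simp add: o_def)
  from openin_continuous_map_preimage[OF this W]
  have "openin X {p \<in> topspace X. p \<otimes> inv a \<in> ?W}" .
  moreover have "{p \<in> topspace X. p \<otimes> inv a \<in> ?W}
      = {p \<in> carrier G. p \<otimes> inv a \<in> fst chart_one \<and> norm (coord (p \<otimes> inv a) - origin) < e}"
    using a topspace_eq_carrier by (auto simp: dist_norm norm_minus_commute)
  ultimately show ?thesis by simp
qed

text \<open>
  Closeness to \<open>r\<close> is required on the finitely many generators only, which gives an open set in the
  topology of pointwise convergence.
\<close>

definition near_homs :: "real \<Rightarrow> ('c \<Rightarrow> 'g) set" where
  "near_homs e = {r' \<in> Hom \<Gamma> G. \<forall>s\<in>S. r' (\<pi> s) \<otimes> inv (\<rho> s) \<in> fst chart_one \<and>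
     norm (coord (r' (\<pi> s) \<otimes> inv (\<rho> s)) - origin) < e}"

lemma Hom_subset_topspace: "Hom \<Gamma> G \<subseteq> topspace (product_topology (\<lambda>_. X) (carrier \<Gamma>))"
  using topspace_eq_carrier by (auto simp: Hom_def PiE_iff hom_def extensional_def)

lemma openin_near_homs: "openin (Hom_topology \<Gamma> G X) (near_homs e)"
proof -
  let ?P = "product_topology (\<lambda>_. X) (carrier \<Gamma>)"
  let ?N = "\<lambda>s. {p \<in> carrier G. p \<otimes> inv (\<rho> s) \<in> fst chart_one \<and> norm (coord (p \<otimes> inv (\<rho> s)) - origin) < e}"
  have "openin ?P {f \<in> topspace ?P. f (\<pi> s) \<in> ?N s}" if s: "s \<in> S" for s
    using s S_subset \<rho>_closed \<pi>_closed
    by (intro openin_continuous_map_preimage[OF continuous_map_product_projection] openin_near_element) auto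
  then have "openin ?P ((\<Inter>s\<in>S. {f \<in> topspace ?P. f (\<pi> s) \<in> ?N s}) \<inter> topspace ?P)"
    using finite_S by (intro openin_INT)
  then have "openin (Hom_topology \<Gamma> G X)
      (Hom \<Gamma> G \<inter> ((\<Inter>s\<in>S. {f \<in> topspace ?P. f (\<pi> s) \<in> ?N s}) \<inter> topspace ?P))"
    unfolding Hom_topology_def by (rule openin_subtopology_Int2)
  moreover have "f (\<pi> s) \<in> carrier G" if "f \<in> Hom \<Gamma> G" "s \<in> S" for f s
    using that S_subset \<pi>_closed by (auto simp: Hom_def hom_def)
  then have "Hom \<Gamma> G \<inter> ((\<Inter>s\<in>S. {f \<in> topspace ?P. f (\<pi> s) \<in> ?N s}) \<inter> topspace ?P) = near_homs e"
    using Hom_subset_topspace unfolding near_homs_def by blast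
  ultimately show ?thesis by simp
qed

lemma r_in_near_homs: "e > 0 \<Longrightarrow> r \<in> near_homs e"
  using r S_subset \<rho>_closed chart_one_mem(2) by (auto simp: near_homs_def subset_iff)

text \<open>
  A homomorphism \<open>r'\<close> near \<open>r\<close> satisfies all relations, so its family of generator values is
  \<open>conjugates x\<close> for some \<open>x\<close>. On the generators, \<open>r'\<close> then agrees with \<open>r\<close> conjugated by \<open>param x\<close>.
\<close>

theorem locally_rigid_if_closed_trivial_H1:
  assumes H1: "carrier (H1 F \<iota> \<pi> T S (lie_algebra G A) act) = {\<one>\<^bsub>H1 F \<iota> \<pi> T S (lie_algebra G A) act\<^esub>}"
    and cl: "closedin (product_topology (\<lambda>_. lie_algebra_topology G A) T)
      (delta1 F \<iota> \<pi> T S act ` (S \<rightarrow>\<^sub>E lie_algebra G A))"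
  shows "locally_rigid \<Gamma> G X r"
proof -
  \<comment> \<open>Within \<open>e\<close> the quotients stay in the chart, so equality of coordinates gives equality in \<open>G\<close>.\<close>
  obtain e where e: "e > 0" and near: "\<And>x s. norm (x - origin) < e \<Longrightarrow> s \<in> S \<Longrightarrow>
      param x \<otimes> \<rho> s \<otimes> inv (param x) \<otimes> inv (\<rho> s) \<in> fst chart_one"
    using eventually_conjugates_near_one by (auto simp: eventually_nhds_metric dist_norm)
  have rel0: "relations t (conjugates origin) = origin" if "t \<in> T" for t
    using near[of origin] e that by (intro relations_conjugates) auto
  have conj_K: "conjugates x - conjugates origin \<in> families S" for x
    unfolding conjugates_def by (intro subspace_diff subspace_families family_in_families finite_S)
  have coord_delta0_K: "coord_delta0 v \<in> families S" for v
    unfolding coord_delta0_def by (intro family_in_families finite_S)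
  have rel: "\<forall>\<^sub>F x in nhds origin. \<forall>t\<in>T. relations t (conjugates x) = relations t (conjugates origin)"
    using eventually_conjugates_near_one by eventually_elim (simp add: relations_conjugates rel0)
  obtain d where d: "d > 0" and
    solve: "\<And>y. y - conjugates origin \<in> families S \<Longrightarrow> norm (y - conjugates origin) < d \<Longrightarrow>
      \<forall>t\<in>T. relations t y = relations t (conjugates origin) \<Longrightarrow>
      \<exists>x. norm (x - origin) < e \<and> conjugates x = y"
    by (rule exact_sequence_locally_surjective[where K = "families S" and T = T and f = conjugates
          and f' = coord_delta0 and ?x0.0 = origin and g = relations and g' = coord_delta1 and e = e,
          OF subspace_families closed_families countable_T conjugates_strict_deriv conj_K coord_delta0_K
          relations_strict_deriv rel coord_delta1_exact[OF H1] coord_delta1_closed_image[OF cl] e])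
      (assumption | rule that | blast)+
  \<comment> \<open>Half of \<open>d\<close>, as the norm of a family is bounded only weakly by bounds on its members.\<close>
  have "\<exists>g\<in>carrier G. \<forall>\<gamma>\<in>carrier \<Gamma>. r' \<gamma> = g \<otimes> r \<gamma> \<otimes> inv g" if r': "r' \<in> near_homs (d / 2)" for r'
  proof -
    have hom': "r' \<in> hom \<Gamma> G" using r' by (simp add: near_homs_def Hom_def)
    have cl: "\<rho> s \<in> carrier G" "r' (\<pi> s) \<in> carrier G" if "s \<in> S" for s
      using that S_subset \<rho>_closed \<pi>_closed hom' by (auto simp: hom_def)
    define y where "y = family S (\<lambda>s. coord (r' (\<pi> s) \<otimes> inv (\<rho> s)))"
    have y: "entry y s = coord (r' (\<pi> s) \<otimes> inv (\<rho> s))" if "s \<in> S" for s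
      using that finite_S by (simp add: y_def entry_family)
    have "norm (y - conjugates origin) \<le> d / 2"
    proof (rule norm_le_entries)
      fix s show "norm (entry (y - conjugates origin) s) \<le> d / 2"
        using r' d finite_S
        by (cases "s \<in> S") (auto simp: y_def conjugates_origin entry_family near_homs_def intro: less_imp_le)
    qed
    then have "norm (y - conjugates origin) < d" using d by simp
    moreover have "y - conjugates origin \<in> families S"
      unfolding y_def conjugates_def by (intro subspace_diff subspace_families family_in_families finite_S)
    moreover have "\<forall>t\<in>T. relations t y = relations t (conjugates origin)"
    proof
      fix t assume t: "t \<in> T"
      have "param (entry y s) \<otimes> \<rho> s = r' (\<pi> s)" if s: "s \<in> S" for s
      proof -
        have "param (entry y s) = r' (\<pi> s) \<otimes> inv (\<rho> s)"
          using s r' by (simp add: y near_homs_def param_coord)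
        then show ?thesis using cl[OF s] by (simp add: m_assoc)
      qed
      then have "word_subst G (\<lambda>s. param (entry y s) \<otimes> \<rho> s) (relator t) = \<one>"
        by (intro hom_relator[OF hom' t])
      then show "relations t y = relations t (conjugates origin)"
        using rel0[OF t] by (simp add: relations_def)
    qed
    ultimately obtain x where x: "norm (x - origin) < e" "conjugates x = y" using solve by blast
    have gen: "r' (\<pi> s) = param x \<otimes> \<rho> s \<otimes> inv (param x)" if s: "s \<in> S" for s
    proof -
      have "coord (param x \<otimes> \<rho> s \<otimes> inv (param x) \<otimes> inv (\<rho> s)) = coord (r' (\<pi> s) \<otimes> inv (\<rho> s))"
        using arg_cong[OF x(2), of "\<lambda>z. entry z s"] s finite_S y[OF s] by (simp add: conjugates_def entry_family)
      moreover have "r' (\<pi> s) \<otimes> inv (\<rho> s) \<in> fst chart_one" using r' s by (simp add: near_homs_def)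
      ultimately have "param x \<otimes> \<rho> s \<otimes> inv (param x) \<otimes> inv (\<rho> s) = r' (\<pi> s) \<otimes> inv (\<rho> s)"
        using near[OF x(1) s] inj_coord by (auto dest: inj_onD)
      then show ?thesis using cl[OF s] by simp
    qed
    have "r' \<gamma> = param x \<otimes> r \<gamma> \<otimes> inv (param x)" if "\<gamma> \<in> carrier \<Gamma>" for \<gamma>
      by (rule homs_eq_on_generators[OF hom' conj_hom[OF param_closed] gen that])
    then show ?thesis by (intro bexI[of _ "param x"]) auto
  qed
  moreover have "r \<in> near_homs (d / 2)" using d by (intro r_in_near_homs) simp
  ultimately show ?thesis
    unfolding locally_rigid_def using openin_near_homs by blast
qed

end

theorem theorem5p3:
  fixes G :: "('g, 'm) monoid_scheme" and X :: "'g topology"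
    and A :: "('g, 'e::banach) chart set"
    and \<Gamma> :: "('c, 'n) monoid_scheme"
    and R :: "('t, 'k) monoid_scheme" and F :: "('f, 'l) monoid_scheme"
    and \<iota> :: "'t \<Rightarrow> 'f" and \<pi> :: "'f \<Rightarrow> 'c" and T :: "'t set" and S :: "'f set"
    and r :: "'c \<Rightarrow> 'g"
  assumes "banach_lie_group G X A"
    and "finitely_generated_group \<Gamma>"
    and "presentation R F \<Gamma> \<iota> \<pi> T S"
    and "r \<in> Hom \<Gamma> G"
    and "carrier (H1 F \<iota> \<pi> T S (lie_algebra G A) (\<lambda>\<gamma>. Ad G A (r \<gamma>)))
           = {\<one>\<^bsub>H1 F \<iota> \<pi> T S (lie_algebra G A) (\<lambda>\<gamma>. Ad G A (r \<gamma>))\<^esub>}"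
    and "closedin (product_topology (\<lambda>_. lie_algebra_topology G A) T)
           (delta1 F \<iota> \<pi> T S (\<lambda>\<gamma>. Ad G A (r \<gamma>)) ` (S \<rightarrow>\<^sub>E lie_algebra G A))"
  shows "locally_rigid \<Gamma> G X r"
proof -
  interpret lie_group_representation G X A R F \<Gamma> \<iota> \<pi> T S r
    using assms by (simp add: lie_group_representation_def lie_group_representation_axioms_def)
  show ?thesis using assms(5,6) by (rule locally_rigid_if_closed_trivial_H1)
qed

end
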